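(* Let $q$ be a prime power, $n\ge 1$ and $1\le d\le n$ integers, and let $X=X(n,q)$ be the set of $n\times n$ Hermitian matrices over $\mathbb{F}_{q^2}$. Every additive $d$-code $Y$ in $X$ satisfies \[ |Y|\le q^{n(n-d+1)}. \] Moreover, if $d$ is odd, then this bound also holds for arbitrary (not necessarily additive) $d$-codes $Y$ in $X$, and equality $|Y|=q^{n(n-d+1)}$ holds if and only if $Y$ is an $(n-d+1)$-design.
   Context: For $x\in\mathbb{F}_{q^2}$ write $\overline{x}=x^q$; for a matrix $A$ over $\mathbb{F}_{q^2}$, $A^*$ denotes the conjugate transpose (entrywise conjugation followed by transposition). A square matrix $A$ is Hermitian if $A^*=A$. $X=X(n,q)$ is an abelian group under addition. A nonempty subset $Y\subseteq X$ is a $d$-code if $\operatorname{rank}(A-B)\ge d$ for all distinct $A,B\in Y$; it is additive if it is a subgroup of $(X,+)$. Fix a nontrivial character $\chi$ of $(\mathbb{F}_q,+)$ and for $A,B\in X$ put $\langle A,B\rangle=\chi(\operatorname{tr}(A^*B))$ ($\operatorname{tr}$ the matrix trace; this lies in $\mathbb{F}_q$). Let $X_k$ be the set of matrices in $X$ of rank $k$. For $i,k\in\{0,\dots,n\}$ let $Q_k(i)=\sum_{A\in X_k}\langle A,B\rangle$ for any $B\in X_i$ (this value does not depend on the choice of $B\in X_i$). The inner distribution of a nonempty $Y\subseteq X$ is $(A_0,\dots,A_n)$ with $A_i=|\{(x,y)\in Y\times Y:\operatorname{rank}(x-y)=i\}|/|Y|$, and its dual inner distribution is $(A'_0,\dots,A'_n)$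 with $A'_k=\sum_{i=0}^n Q_k(i)A_i$. $Y$ is a $t$-design if $A'_1=\dots=A'_t=0$. *)

theory Defs
  imports "Jordan_Normal_Form.DL_Rank" Complex_Main
begin

(* Field F_{q^2} is a finite field type 'a with CARD('a) = q^2;
   conjugation x |-> x^q. Matrices are Jordan_Normal_Form 'a mat. *)

definition conj_q :: "nat \<Rightarrow> 'a::field \<Rightarrow> 'a" where
  "conj_q q x = x ^ q"

definition conj_transpose :: "nat \<Rightarrow> 'a::field mat \<Rightarrow> 'a mat" where
  "conj_transpose q A = mat (dim_col A) (dim_row A) (\<lambda>(i,j). conj_q q (A $$ (j,i)))"

definition mat_trace :: "'a::comm_ring_1 mat \<Rightarrow> 'a" where
  "mat_trace A = (\<Sum>i<dim_row A. A $$ (i,i))"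

definition mrank :: "'a::field mat \<Rightarrow> nat" where
  "mrank A = vec_space.rank (dim_row A) A"

definition herm :: "nat \<Rightarrow> nat \<Rightarrow> 'a::field mat set" where
  "herm q n = {A \<in> carrier_mat n n. conj_transpose q A = A}"

definition subfield_q :: "nat \<Rightarrow> 'a::field set" where
  "subfield_q q = {x. x ^ q = x}"

definition nontrivial_char :: "nat \<Rightarrow> ('a::field \<Rightarrow> complex) \<Rightarrow> bool" where
  "nontrivial_char q \<chi> \<longleftrightarrow>
     (\<forall>x\<in>subfield_q q. \<chi> x \<noteq> 0) \<and>
     (\<forall>x\<in>subfield_q q. \<forall>y\<in>subfield_q q. \<chi> (x + y) = \<chi> x * \<chi> y) \<and>
     (\<exists>x\<in>subfield_q q. \<chi> x \<noteq> 1)"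

definition pairing :: "nat \<Rightarrow> ('a::field \<Rightarrow> complex) \<Rightarrow> 'a mat \<Rightarrow> 'a mat \<Rightarrow> complex" where
  "pairing q \<chi> A B = \<chi> (mat_trace (conj_transpose q A * B))"

definition d_code :: "nat \<Rightarrow> nat \<Rightarrow> nat \<Rightarrow> 'a::field mat set \<Rightarrow> bool" where
  "d_code q n d Y \<longleftrightarrow> Y \<noteq> {} \<and> Y \<subseteq> herm q n \<and>
     (\<forall>A\<in>Y. \<forall>B\<in>Y. A \<noteq> B \<longrightarrow> mrank (A - B) \<ge> d)"

definition additive_code :: "nat \<Rightarrow> nat \<Rightarrow> 'a::field mat set \<Rightarrow> bool" where
  "additive_code q n Y \<longleftrightarrow> Y \<subseteq> herm q n \<and> 0\<^sub>m n n \<in> Y \<and>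
     (\<forall>A\<in>Y. \<forall>B\<in>Y. A + B \<in> Y) \<and> (\<forall>A\<in>Y. - A \<in> Y)"

definition herm_rank :: "nat \<Rightarrow> nat \<Rightarrow> nat \<Rightarrow> 'a::field mat set" where
  "herm_rank q n k = {A \<in> herm q n. mrank A = k}"

(* Q_k(i) = sum_{A in X_k} <A,B> for any B in X_i *)
definition Qnum :: "nat \<Rightarrow> nat \<Rightarrow> ('a::field \<Rightarrow> complex) \<Rightarrow> nat \<Rightarrow> nat \<Rightarrow> complex" where
  "Qnum q n \<chi> k i = (let B = (SOME B. B \<in> herm_rank q n i) in
      (\<Sum>A\<in>herm_rank q n k. pairing q \<chi> A B))"

definition inner_dist :: "nat \<Rightarrow> 'a::field mat set \<Rightarrow> nat \<Rightarrow> real" where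
  "inner_dist n Y i = real (card {(x,y). x \<in> Y \<and> y \<in> Y \<and> mrank (x - y) = i}) / real (card Y)"

definition dual_inner_dist :: "nat \<Rightarrow> nat \<Rightarrow> ('a::field \<Rightarrow> complex) \<Rightarrow> 'a mat set \<Rightarrow> nat \<Rightarrow> complex" where
  "dual_inner_dist q n \<chi> Y k = (\<Sum>i\<le>n. Qnum q n \<chi> k i * complex_of_real (inner_dist n Y i))"

definition is_design :: "nat \<Rightarrow> nat \<Rightarrow> ('a::field \<Rightarrow> complex) \<Rightarrow> nat \<Rightarrow> 'a mat set \<Rightarrow> bool" where
  "is_design q n \<chi> t Y \<longleftrightarrow> Y \<noteq> {} \<and> Y \<subseteq> herm q n \<and>
     (\<forall>k\<in>{1..t}. dual_inner_dist q n \<chi> Y k = 0)"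

end

theory Submission
  imports Defs "HOL-Computational_Algebra.Polynomial" "HOL-Number_Theory.Residues"
begin

text \<open>
  Put \<open>b = -q\<close> and write \<open>[u, s]\<close> for the Gaussian binomial coefficient with base \<open>b\<close>. Everything
  rests on the Fourier transform of the rank function \<open>A \<mapsto> [n - rank A, s]\<close> on the Hermitian
  matrices:
  \[ \sum_A [n - rank A, s] \langle A, B \rangle = (-b^n)^{n-s} [n - rank B, n - s]. \]
  It is proved by induction on \<open>s\<close>. The Gauss sum \<open>\<Sum>x. \<chi> (x\<^sup>* A x)\<close> equals \<open>b ^ (2 n - rank A)\<close>, so
  summing the transform over all rank-one updates \<open>B + x x\<^sup>*\<close> multiplies the weight by
  \<open>b ^ (2 n - rank A)\<close>, which turns \<open>[n - rank A, s]\<close> into a combination of itself and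
  \<open>[n - rank A, s + 1]\<close>; on the other side one counts how often the update raises, keeps or lowers
  the rank of \<open>B\<close>.

  Take \<open>s = d - 1\<close> and sum over \<open>B = x - y\<close> with \<open>x, y\<close> in a \<open>d\<close>-code \<open>Y\<close>: only \<open>x = y\<close> survives on the
  right, while the left is a combination of the squared Fourier coefficients of \<open>Y\<close>, that is, of
  its dual inner distribution. If \<open>d\<close> is odd, all \<open>[n - k, d - 1]\<close> are nonnegative, and positive
  exactly for \<open>k \<le> n - d + 1\<close>, which gives the bound and the case of equality. If \<open>Y\<close> is additive, the
  Fourier coefficients are \<open>0\<close> or \<open>|Y|\<close>, so \<open>|Y|\<close> divides \<open>q ^ (n (n - d + 1)) [n, d - 1]\<close>; the second
  factor is \<open>1\<close> modulo \<open>q\<close> and \<open>|Y|\<close> divides a power of \<open>q\<close>.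
\<close>

section \<open>Gaussian binomial coefficients\<close>

fun gauss_binom :: "'b::comm_ring_1 \<Rightarrow> nat \<Rightarrow> nat \<Rightarrow> 'b" where
  "gauss_binom b n 0 = 1"
| "gauss_binom b 0 (Suc k) = 0"
| "gauss_binom b (Suc n) (Suc k) = gauss_binom b n k + b ^ Suc k * gauss_binom b n (Suc k)"

lemma gauss_binom_eq_0: "n < k \<Longrightarrow> gauss_binom b n k = 0"
  by (induction b n k rule: gauss_binom.induct) auto

lemma gauss_binom_diag [simp]: "gauss_binom b n n = 1"
  by (induction n) (auto simp: gauss_binom_eq_0)

lemma of_int_gauss_binom: "of_int (gauss_binom b n k) = gauss_binom (of_int b) n k"
  by (induction b n k rule: gauss_binom.induct) auto

text \<open>The second q-Pascal rule. The defining rule is expanded once, the induction hypothesis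
  is applied to both summands, and regrouping gives the defining rule one level down. Comparing the
  two rules yields the absorption identities below.\<close>

lemma gauss_binom_Suc_Suc':
  "k \<le> n \<Longrightarrow> gauss_binom b (Suc n) (Suc k) = gauss_binom b n (Suc k) + b ^ (n - k) * gauss_binom b n k"
proof (induction n arbitrary: k)
  case 0
  then show ?case by simp
next
  case (Suc n)
  show ?case
  proof (cases k)
    case 0
    have "gauss_binom b (Suc n) (Suc 0) = gauss_binom b n (Suc 0) + b ^ n"
      using Suc.IH[of 0] by simp
    then show ?thesis using 0
      by (simp add: algebra_simps)
  next
    case k: (Suc j)
    show ?thesis
    proof (cases "k = Suc n")
      case True
      then show ?thesis by (simp add: gauss_binom_eq_0)
    next
      case False
      with Suc.prems k have j: "j \<le> n" "Suc j \<le> n" by auto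
      have e: "n - j = Suc (n - Suc j)" using j by simp
      have "gauss_binom b (Suc (Suc n)) (Suc k) =
          gauss_binom b (Suc n) k + b ^ Suc k * gauss_binom b (Suc n) (Suc k)" by simp
      also have "\<dots> = (gauss_binom b n k + b ^ (n - j) * gauss_binom b n j)
          + b ^ Suc k * (gauss_binom b n (Suc k) + b ^ (n - k) * gauss_binom b n k)"
        using Suc.IH[OF j(1)] Suc.IH[OF j(2)] k by simp
      also have "\<dots> = (gauss_binom b n k + b ^ Suc k * gauss_binom b n (Suc k))
          + b ^ (n - j) * (gauss_binom b n j + b ^ k * gauss_binom b n k)"
        using k e by (simp add: algebra_simps)
      also have "\<dots> = gauss_binom b (Suc n) (Suc k) + b ^ (Suc n - k) * gauss_binom b (Suc n) k"
        using k by simp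
      finally show ?thesis .
    qed
  qed
qed

text \<open>The difference of the two Pascal rules; a division-free substitute for the product
  formula.\<close>

lemma gauss_binom_absorb_Suc:
  assumes "k \<le> n"
  shows "(b ^ Suc k - 1) * gauss_binom b n (Suc k) = (b ^ (n - k) - 1) * gauss_binom b n k"
  using gauss_binom_Suc_Suc'[OF assms, of b] by (simp add: algebra_simps)

lemma gauss_binom_symmetric: "k \<le> n \<Longrightarrow> gauss_binom b n (n - k) = gauss_binom b n k"
proof (induction n arbitrary: k)
  case 0
  then show ?case by simp
next
  case (Suc n)
  show ?case
  proof (cases "k = 0 \<or> k = Suc n")
    case True
    then show ?thesis by auto
  next
    case False
    then obtain j where k: "k = Suc j" "j < n" using Suc.prems by (cases k) auto
    have e: "Suc n - k = Suc (n - Suc j)" using k by simp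
    have "gauss_binom b (Suc n) (Suc n - k) =
       gauss_binom b n (Suc (n - Suc j)) + b ^ (n - (n - Suc j)) * gauss_binom b n (n - Suc j)"
      unfolding e using k by (intro gauss_binom_Suc_Suc') simp
    also have "Suc (n - Suc j) = n - j" using k by simp
    finally show ?thesis using k Suc.IH[of j] Suc.IH[of "Suc j"] by simp
  qed
qed

text \<open>The factors \<open>(-q) ^ j - 1\<close> alternate in sign, so two consecutive ones have
  a negative product. Two absorption steps lead from \<open>j\<close> to \<open>j + 2\<close> and
  multiply by a quotient of two such products, which is positive; hence the restriction to even
  \<open>k\<close>.\<close>

lemma gauss_binom_pos:
  fixes q :: int
  assumes "2 \<le> q" "even k" "k \<le> n"
  shows "0 < gauss_binom (-q) n k"
  using assms(2,3)
proof (induction k rule: less_induct)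
  case (less k)
  have neg: "((-q) ^ Suc j - 1) * ((-q) ^ j - 1) < 0" if "j \<ge> 1" for j
  proof -
    have big: "q ^ i > 1" if "i \<ge> 1" for i using that assms(1) by (simp add: one_less_power)
    show ?thesis
    proof (cases "even j")
      case True
      then have "(-q) ^ Suc j - 1 < 0" "(-q) ^ j - 1 > 0"
        using big[OF that] big[of "Suc j"] by (auto simp: power_minus_odd)
      then show ?thesis by (rule mult_neg_pos)
    next
      case False
      then have "(-q) ^ Suc j - 1 > 0" "(-q) ^ j - 1 < 0"
        using big[OF that] big[of "Suc j"] by (auto simp: power_minus_odd)
      then show ?thesis by (rule mult_pos_neg)
    qed
  qed
  show ?case
  proof (cases "k = 0")
    case False
    with less.prems obtain j where k: "k = Suc (Suc j)" "even j"
      using that[of "k - 2"] by (cases k; cases "k - 1") auto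
    define c where "c = n - Suc j"
    have c: "n - j = Suc c" "c \<ge> 1" using less.prems k by (auto simp: c_def)
    define x y z w where "x = (-q) ^ Suc (Suc j) - 1" and "y = (-q) ^ Suc j - 1"
      and "z = (-q) ^ Suc c - 1" and "w = (-q) ^ c - 1"
    have 1: "x * gauss_binom (-q) n k = w * gauss_binom (-q) n (Suc j)"
      using gauss_binom_absorb_Suc[of "Suc j" n "-q"] less.prems k unfolding x_def w_def c_def by simp
    have 2: "y * gauss_binom (-q) n (Suc j) = z * gauss_binom (-q) n j"
      using gauss_binom_absorb_Suc[of j n "-q"] less.prems k c(1) unfolding y_def z_def by simp
    have "(x * y) * gauss_binom (-q) n k = y * (x * gauss_binom (-q) n k)" by simp
    also have "\<dots> = w * (y * gauss_binom (-q) n (Suc j))" unfolding 1 by simp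
    also have "\<dots> = (z * w) * gauss_binom (-q) n j" unfolding 2 by simp
    finally have "(x * y) * gauss_binom (-q) n k = (z * w) * gauss_binom (-q) n j" .
    moreover have "0 < gauss_binom (-q) n j" using less.IH[of j] less.prems k by auto
    moreover have "z * w < 0" "x * y < 0"
      using neg[OF c(2)] neg[of "Suc j"] unfolding x_def y_def z_def w_def by auto
    ultimately show ?thesis
      by (metis mult_less_0_iff not_less_iff_gr_or_eq)
  qed simp
qed

text \<open>Modulo \<open>p\<close> the defining recursion loses its second term and runs down to
  \<open>k = 0\<close>.\<close>

lemma gauss_binom_mod:
  fixes b :: int
  assumes "p dvd b" "k \<le> n"
  shows "p dvd gauss_binom b n k - 1"
  using assms
proof (induction b n k rule: gauss_binom.induct)
  case (3 b n k)
  have "gauss_binom b (Suc n) (Suc k) - 1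
      = (gauss_binom b n k - 1) + b * (b ^ k * gauss_binom b n (Suc k))" by simp
  then show ?case using 3 by (metis dvd_add dvd_mult2 Suc_le_mono)
qed auto

text \<open>Both Pascal rules again, combined so that \<open>gauss_binom b (k + e) k\<close>
  cancels. This shifts the upper index; writing it as \<open>k + e\<close> avoids
  subtraction.\<close>

lemma gauss_binom_absorb_upper:
  "(b ^ Suc (k + e) - 1) * gauss_binom b (k + e) (Suc k) = (b ^ e - 1) * gauss_binom b (Suc (k + e)) (Suc k)"
proof -
  have 1: "gauss_binom b (Suc (k + e)) (Suc k) = gauss_binom b (k + e) k + b ^ Suc k * gauss_binom b (k + e) (Suc k)"
    by simp
  have 2: "gauss_binom b (Suc (k + e)) (Suc k) = gauss_binom b (k + e) (Suc k) + b ^ e * gauss_binom b (k + e) k"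
    using gauss_binom_Suc_Suc'[of k "k + e" b] by simp
  have "(b ^ e - 1) * gauss_binom b (Suc (k + e)) (Suc k)
      = b ^ e * gauss_binom b (Suc (k + e)) (Suc k) - gauss_binom b (Suc (k + e)) (Suc k)"
    by (simp add: left_diff_distrib)
  also have "\<dots> = b ^ e * (gauss_binom b (k + e) k + b ^ Suc k * gauss_binom b (k + e) (Suc k))
      - (gauss_binom b (k + e) (Suc k) + b ^ e * gauss_binom b (k + e) k)"
    by (metis 1 2)
  finally show ?thesis by (simp add: algebra_simps power_add)
qed

text \<open>The arithmetic of the induction step for the Fourier transform. Here \<open>i\<close>
  and \<open>u\<close> are the rank and nullity of a form, and the coefficients of the values at
  \<open>u - 1\<close>, \<open>u + 1\<close> and \<open>u\<close> are the numbers of rank-one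
  updates that lower, raise and keep the nullity. For \<open>u = 0\<close> the truncated
  \<open>u - 1\<close> is harmless, since the coefficient in front vanishes.\<close>

lemma gauss_binom_recurrence:
  fixes b M :: "'b::field"
  assumes b: "b \<noteq> 0" and M: "b * M = - (b ^ i * (b ^ i - 1))" and n: "n = i + u" "n = s + Suc k"
  shows "(b ^ (2 * n) - b ^ (2 * i)) * gauss_binom b (u - 1) (Suc k) + M * gauss_binom b (u + 1) (Suc k)
      + (b ^ (2 * i) - M) * gauss_binom b u (Suc k) - b ^ (n + s) * gauss_binom b u (Suc k)
    = - (b ^ s * (b ^ Suc s - 1) * gauss_binom b u k)"
proof -
  consider "u < k" | "u = k" | "u > k" by linarith
  then show ?thesis
  proof cases
    case 1
    then show ?thesis by (simp add: gauss_binom_eq_0)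
  next
    case 2
    then have i: "i = Suc s" using n by simp
    have "b * M = b * (- (b ^ s * (b ^ Suc s - 1)))" using M i by simp
    then have "M = - (b ^ s * (b ^ Suc s - 1))" by (simp only: mult_left_cancel[OF b])
    then show ?thesis using 2 by (simp add: gauss_binom_eq_0)
  next
    case 3
    then obtain e where u: "u = Suc (k + e)" using less_imp_Suc_add by blast
    have s: "s = i + e" using n u by simp
    define g0 g1 g2 gm where "g0 = gauss_binom b u k" and "g1 = gauss_binom b u (Suc k)"
      and "g2 = gauss_binom b (u + 1) (Suc k)" and "gm = gauss_binom b (u - 1) (Suc k)"
    define a E P where "a = b ^ i" and "E = b ^ e" and "P = b ^ Suc k"
    have r1: "(P - 1) * g1 = (E * b - 1) * g0"
      using gauss_binom_absorb_Suc[of k u b] u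
      unfolding g0_def g1_def P_def E_def by (simp add: mult.commute)
    have r2: "g2 = g1 + E * b * g0"
      using gauss_binom_Suc_Suc'[of k u b] u
      unfolding g0_def g1_def g2_def E_def by (simp add: mult.commute)
    have r3: "(P * E - 1) * gm = (E - 1) * g1"
      using gauss_binom_absorb_upper[of b k e] u
      unfolding gm_def g1_def E_def P_def by (simp add: power_add mult.assoc)
    have p: "b ^ (2 * n) = (a * P * E) ^ 2" "b ^ (2 * i) = a ^ 2" "b ^ (n + s) = a ^ 2 * P * E ^ 2"
      "b ^ s = a * E"
      unfolding a_def E_def P_def n(1) u s
      by (simp_all add: power_add power2_eq_square power_mult_distrib mult_ac mult_2 mult_2_right)
    have M': "M * (E * b) = - a * (a - 1) * E" using M unfolding a_def by (simp add: mult_ac)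
    \<comment> \<open>\<open>r2\<close> removes \<open>g2\<close>; the factor of \<open>gm\<close>
      splits as \<open>a ^ 2 * (P * E + 1) * (P * E - 1)\<close>, so that \<open>r3\<close> applies;
      finally \<open>r1\<close> turns the remaining \<open>g1\<close> into
      \<open>g0\<close>.\<close>
    have "((a * P * E) ^ 2 - a ^ 2) * gm + M * g2 + (a ^ 2 - M) * g1 - a ^ 2 * P * E ^ 2 * g1
        = a ^ 2 * (P * E + 1) * ((P * E - 1) * gm) + (M * (E * b)) * g0 + a ^ 2 * g1 - a ^ 2 * P * E ^ 2 * g1"
      unfolding r2 by (simp add: algebra_simps power2_eq_square)
    also have "\<dots> = - (a ^ 2) * E * ((P - 1) * g1) - a * (a - 1) * E * g0"
      unfolding r3 M' by (simp add: algebra_simps power2_eq_square)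
    also have "\<dots> = - (a * E) * (a * E * b - 1) * g0"
      unfolding r1 by (simp add: algebra_simps power2_eq_square)
    finally show ?thesis using p unfolding g0_def g1_def g2_def gm_def
      by (simp add: mult_ac)
  qed
qed

section \<open>Counting over a finite field\<close>

lemma card_carrier_vec_finite:
  "finite (carrier_vec n :: 'a::finite vec set)"
  "card (carrier_vec n :: 'a::finite vec set) = card (UNIV :: 'a set) ^ n"
proof -
  have "bij_betw (\<lambda>f. vec n f) ({..<n} \<rightarrow>\<^sub>E (UNIV :: 'a set)) (carrier_vec n)"
    by (rule bij_betwI[of _ _ _ "\<lambda>v. restrict (vec_index v) {..<n}"])
       (auto simp: PiE_def extensional_def restrict_def fun_eq_iff)
  from bij_betw_finite[OF this] bij_betw_same_card[OF this] card_PiE[of "{..<n}" "\<lambda>_. UNIV :: 'a set"]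
  show "finite (carrier_vec n :: 'a::finite vec set)"
    "card (carrier_vec n :: 'a::finite vec set) = card (UNIV :: 'a set) ^ n"
    by (auto simp: finite_PiE)
qed

lemma finite_carrier_mat: "finite (carrier_mat n m :: 'a::finite mat set)"
proof -
  have "carrier_mat n m \<subseteq> (\<lambda>f. mat n m f) ` (({..<n} \<times> {..<m}) \<rightarrow>\<^sub>E (UNIV :: 'a set))"
  proof
    fix A :: "'a mat" assume "A \<in> carrier_mat n m"
    then show "A \<in> (\<lambda>f. mat n m f) ` (({..<n} \<times> {..<m}) \<rightarrow>\<^sub>E UNIV)"
      by (intro image_eqI[of _ _ "restrict (\<lambda>ij. A $$ ij) ({..<n} \<times> {..<m})"]) auto
  qed
  then show ?thesis by (rule finite_subset) (simp add: finite_PiE)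
qed

text \<open>A generator outside \<open>span U\<close> could be adjoined to \<open>U\<close> without
  losing independence.\<close>

lemma (in vectorspace) span_maximal_lin_indpt:
  assumes "S \<subseteq> carrier V" "maximal U (\<lambda>T. T \<subseteq> S \<and> lin_indpt T)"
  shows "span U = span S"
proof (rule ccontr)
  have U: "lin_indpt U" "U \<subseteq> S" using assms(2) by (auto simp: maximal_def)
  assume "span U \<noteq> span S"
  then have "\<not> S \<subseteq> span U"
    by (meson U(2) assms(1) span_is_monotone span_is_submodule span_is_subset subset_antisym subset_trans)
  then obtain s where s: "s \<in> S" "s \<notin> span U" by blast
  have "lin_indpt (U \<union> {s})"
    by (meson U assms(1) lin_dep_iff_in_span s rev_subsetD span_mem subset_trans)
  moreover have "s \<notin> U" using U(2) s(2) assms(1) span_mem by auto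
  ultimately show False using assms(2) U s unfolding maximal_def by blast
qed

text \<open>A maximal independent set of columns forms a matrix \<open>M\<close> that is injective
  and has the same column space as \<open>A\<close>. From here on, ranks are handled by counting
  ranges and kernels.\<close>

lemma card_range_mult_mat_vec:
  fixes A :: "'a::{finite,field} mat"
  assumes A: "A \<in> carrier_mat n n"
  shows "card ((\<lambda>v. A *\<^sub>v v) ` carrier_vec n) = card (UNIV :: 'a set) ^ mrank A"
proof -
  interpret vec_space "TYPE('a)" n .
  let ?P = "\<lambda>T. T \<subseteq> set (cols A) \<and> lin_indpt T"
  have cols: "set (cols A) \<subseteq> carrier_vec n" using cols_dim A by blast
  have "?P {}" by (auto simp: lin_dep_def)
  then obtain S where S: "maximal S ?P" "finite S"
    using maximal_exists_superset[of "set (cols A)" ?P "{}"] by auto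
  then have Sp: "S \<subseteq> set (cols A)" "lin_indpt S" by (auto simp: maximal_def)
  have rk: "mrank A = card S"
    using rank_card_indpt[OF A S(1)] A by (simp add: mrank_def)
  obtain ss where ss: "set ss = S" "distinct ss" using finite_distinct_list S(2) by blast
  define M where "M = mat_of_cols n ss"
  have M: "M \<in> carrier_mat n (card S)"
    using ss distinct_card[of ss] by (auto simp: M_def)
  have colsM: "cols M = ss"
    unfolding M_def using ss Sp cols by (intro cols_mat_of_cols) auto
  have col_range: "col_space B = (\<lambda>v. B *\<^sub>v v) ` carrier_vec m" if "B \<in> carrier_mat n m" for B m
    using col_space_eq[OF that] that by auto
  have "inj_on (\<lambda>v. M *\<^sub>v v) (carrier_vec (card S))"
  proof (rule inj_onI)
    fix v w assume v: "v \<in> carrier_vec (card S)" and w: "w \<in> carrier_vec (card S)" and e: "M *\<^sub>v v = M *\<^sub>v w"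
    have "M *\<^sub>v (v - w) = M *\<^sub>v v - M *\<^sub>v w" using mult_minus_distrib_mat_vec[OF M v w] .
    also have "\<dots> = 0\<^sub>v n" using e M w by auto
    finally have z: "M *\<^sub>v (v - w) = 0\<^sub>v n" .
    have "v - w = 0\<^sub>v (card S)"
    proof (rule ccontr)
      assume "v - w \<noteq> 0\<^sub>v (card S)"
      then have "lin_dep (set (cols M))"
        using lin_depI[OF M _ _ z] v w colsM ss(2) by auto
      then show False using Sp(2) colsM ss by simp
    qed
    then show "v = w" using v w
      by (metis add.comm_neutral carrier_vecD comm_add_vec eq_vecI index_minus_vec(1) index_zero_vec(1) right_minus_eq)
  qed
  then have "card ((\<lambda>v. M *\<^sub>v v) ` carrier_vec (card S)) = card (carrier_vec (card S) :: 'a vec set)"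
    by (rule card_image)
  moreover have "(\<lambda>v. A *\<^sub>v v) ` carrier_vec n = (\<lambda>v. M *\<^sub>v v) ` carrier_vec (card S)"
    using span_maximal_lin_indpt[of "set (cols A)" S] cols S(1) col_range[OF A] col_range[OF M] colsM ss
    unfolding col_space_def by auto
  ultimately show ?thesis using rk by (simp add: card_carrier_vec_finite)
qed

section \<open>Finite fields and characters\<close>

text \<open>Reindexing by the permutation multiplies the sum by \<open>c\<close>. All orthogonality
  relations for characters below are instances.\<close>

lemma sum_eq_0_if_shift:
  fixes g :: "'b \<Rightarrow> complex"
  assumes "bij_betw \<sigma> S S" "\<And>s. s \<in> S \<Longrightarrow> g (\<sigma> s) = c * g s" "c \<noteq> 1"
  shows "sum g S = 0"
proof -
  have "sum g S = c * sum g S"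
    using sum.reindex_bij_betw[OF assms(1), of g] assms(2) by (simp add: sum_distrib_left)
  then show ?thesis using assms(3) by simp
qed

locale hermitian_forms =
  fixes q n :: nat and \<chi> :: "'a::{finite,field} \<Rightarrow> complex"
  assumes prime_power_q: "\<exists>p k. prime p \<and> k \<ge> 1 \<and> q = p ^ k"
    and card_field: "card (UNIV :: 'a set) = q ^ 2"
    and nontrivial_char: "nontrivial_char q \<chi>"
begin

abbreviation K :: "'a set" where "K \<equiv> subfield_q q"

lemma q_ge_2: "q \<ge> 2"
proof -
  from prime_power_q obtain p k where pk: "prime p" "k \<ge> 1" "q = p ^ k" by auto
  then have "p ^ 1 \<le> p ^ k" by (intro power_increasing) (auto intro: prime_gt_0_nat Suc_leI)
  with pk show ?thesis using prime_ge_2_nat[of p] by simp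
qed

text \<open>The characteristic divides the order \<open>q ^ 2\<close> of the field, so it is the
  prime underlying \<open>q\<close>. Conjugation is thus a power of Frobenius, hence
  additive.\<close>

lemma q_char_power: "prime CHAR('a)" "\<exists>k. q = CHAR('a) ^ k"
proof -
  have "CHAR('a) > 0" by (rule finite_imp_CHAR_pos) simp
  then show pr: "prime CHAR('a)" by (rule prime_CHAR_semidom)
  from prime_power_q obtain p k where pk: "prime p" "k \<ge> 1" "q = p ^ k" by auto
  have "CHAR('a) dvd p ^ (k * 2)" using CHAR_dvd_CARD[where 'a='a] card_field pk by (simp add: power_mult)
  then have "CHAR('a) dvd p" using pr prime_dvd_power by blast
  then have "CHAR('a) = p" using pr pk primes_dvd_imp_eq by blast
  then show "\<exists>k. q = CHAR('a) ^ k" using pk by auto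
qed

lemma conj_add: "(x + y :: 'a) ^ q = x ^ q + y ^ q"
  using q_char_power freshmans_dream' by blast

lemma conj_0 [simp]: "(0::'a) ^ q = 0"
  using q_ge_2 by simp

lemma conj_sum: "(\<Sum>i\<in>I. f i :: 'a) ^ q = (\<Sum>i\<in>I. f i ^ q)"
  using q_char_power freshmans_dream_sum' by blast

lemma conj_minus: "(- x :: 'a) ^ q = - (x ^ q)"
  using conj_add[of x "-x"] by (simp add: eq_neg_iff_add_eq_0 add.commute)

lemma conj_diff: "(x - y :: 'a) ^ q = x ^ q - y ^ q"
  using conj_add[of x "-y"] conj_minus by simp

text \<open>Multiplication by a nonzero \<open>x\<close> permutes the nonzero elements; comparing
  the products over them gives \<open>x ^ q ^ 2 = x\<close>.\<close>

lemma conj_conj: "((x :: 'a) ^ q) ^ q = x"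
proof (cases "x = 0")
  case False
  have "x * (\<Prod>y\<in>UNIV-{0}. x * y) = x * x ^ (q ^ 2 - 1) * \<Prod>(UNIV-{0})"
    by (simp add: prod.distrib mult_ac card_field)
  also have "x * x ^ (q ^ 2 - 1) = x ^ q ^ 2"
    using q_ge_2 by (simp flip: power_Suc)
  also have "(\<Prod>y\<in>UNIV-{0}. x * y) = (\<Prod>y\<in>UNIV-{0}. y)"
    by (rule prod.reindex_bij_witness[of _ "\<lambda>y. y / x" "\<lambda>y. x * y"]) (use False in auto)
  finally show ?thesis by (simp add: power2_eq_square flip: power_mult)
qed simp

lemma K_iff: "x \<in> K \<longleftrightarrow> x ^ q = x"
  by (simp add: subfield_q_def)

lemma K_closed:
  "0 \<in> K" "1 \<in> K" "x \<in> K \<Longrightarrow> y \<in> K \<Longrightarrow> x + y \<in> K" "x \<in> K \<Longrightarrow> -x \<in> K"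
  "x \<in> K \<Longrightarrow> y \<in> K \<Longrightarrow> x - y \<in> K" "x \<in> K \<Longrightarrow> y \<in> K \<Longrightarrow> x * y \<in> K"
  "x \<in> K \<Longrightarrow> y \<in> K \<Longrightarrow> x / y \<in> K"
  by (auto simp: K_iff conj_add conj_minus conj_diff power_mult_distrib power_divide)

lemma norm_in_K: "x * x ^ q \<in> K"
  by (simp add: K_iff power_mult_distrib conj_conj mult.commute)

lemma trace_in_K: "x + x ^ q \<in> K"
  by (simp add: K_iff conj_add conj_conj add.commute)

lemma card_power_roots_le:
  fixes t :: 'a
  assumes "m > 0"
  shows "card {z. z ^ m = t} \<le> m"
proof -
  define p where "p = Polynomial.monom 1 m - [:t:]"
  have "Polynomial.coeff p m = 1" using assms by (simp add: p_def coeff_pCons split: nat.split)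
  then have "p \<noteq> 0" by auto
  moreover have "Polynomial.degree p \<le> m" unfolding p_def by (intro degree_diff_le) (auto simp: degree_monom_le)
  moreover have "{z. poly p z = 0} = {z. z ^ m = t}" by (auto simp: p_def poly_monom)
  ultimately show ?thesis using card_poly_roots_bound[of p] by simp
qed

lemma card_K_le: "card K \<le> q"
proof -
  define p :: "'a poly" where "p = Polynomial.monom 1 q - Polynomial.monom 1 1"
  have "Polynomial.coeff p q = 1" using q_ge_2 by (simp add: p_def)
  then have "p \<noteq> 0" by auto
  moreover have "Polynomial.degree p \<le> q" unfolding p_def using q_ge_2
    by (intro degree_diff_le) (auto intro: order.trans[OF degree_monom_le])
  moreover have "{z. poly p z = 0} = K" by (auto simp: p_def poly_monom K_iff)
  ultimately show ?thesis using card_poly_roots_bound[of p] by simp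
qed

text \<open>The trace is a polynomial of degree \<open>q\<close> and cannot vanish at all
  \<open>q ^ 2\<close> elements.\<close>

lemma exists_trace_nonzero: "\<exists>x :: 'a. x + x ^ q \<noteq> 0"
proof (rule ccontr)
  assume "\<not> ?thesis"
  then have all: "x + x ^ q = 0" for x :: 'a by auto
  define p :: "'a poly" where "p = Polynomial.monom 1 q + Polynomial.monom 1 1"
  have "Polynomial.coeff p q = 1" using q_ge_2 by (simp add: p_def)
  then have "p \<noteq> 0" by auto
  moreover have "Polynomial.degree p \<le> q" unfolding p_def using q_ge_2
    by (intro degree_add_le) (auto intro: order.trans[OF degree_monom_le])
  moreover have "{z. poly p z = 0} = UNIV" using all by (auto simp: p_def poly_monom add.commute)
  ultimately have "q ^ 2 \<le> q" using card_poly_roots_bound[of p] card_field by simp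
  then show False using q_ge_2 by (simp add: power2_eq_square)
qed

text \<open>The norm maps the \<open>(q + 1)(q - 1)\<close> units into the at most \<open>q - 1\<close> units of the subfield,
  with fibres of size at most \<open>q + 1\<close>, so all these bounds are attained.\<close>
lemma card_K: "card K = q"
  and card_norm_fibre: "t \<in> K \<Longrightarrow> t \<noteq> 0 \<Longrightarrow> card {z. z * z ^ q = t} = q + 1"
proof -
  have fib: "card {z. z * z ^ q = t} \<le> q + 1" for t :: 'a
    using card_power_roots_le[of "q + 1" t] by simp
  have "UNIV - {0} = (\<Union>t\<in>K - {0}. {z. z * z ^ q = t})"
    using norm_in_K by auto
  then have "card (UNIV - {0 :: 'a}) = (\<Sum>t\<in>K - {0}. card {z. z * z ^ q = t})"
    by (subst card_UN_disjoint[symmetric]) auto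
  then have sum: "q ^ 2 - 1 = (\<Sum>t\<in>K - {0}. card {z. z * z ^ q = t})"
    by (simp add: card_field)
  have cK: "card (K - {0}) = card K - 1" using K_closed(1) by simp
  have sq: "q ^ 2 - 1 = (q - 1) * (q + 1)" using q_ge_2
    by (simp add: power2_eq_square algebra_simps)
  have "(q - 1) * (q + 1) \<le> (card K - 1) * (q + 1)"
    using sum_mono[of "K - {0}" "\<lambda>t. card {z. z * z ^ q = t}" "\<lambda>_. q + 1"] fib sum sq cK by simp
  from mult_right_le_imp_le[OF this] have "q - 1 \<le> card K - 1" by simp
  then show card: "card K = q" using card_K_le q_ge_2 by simp
  show "card {z. z * z ^ q = t} = q + 1" if "t \<in> K" "t \<noteq> 0"
  proof (rule ccontr)
    assume "card {z. z * z ^ q = t} \<noteq> q + 1"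
    then have "card {z. z * z ^ q = t} < q + 1" using fib[of t] by simp
    then have "(\<Sum>t\<in>K - {0}. card {z. z * z ^ q = t}) < (\<Sum>t\<in>K - {0}. q + 1)"
      using fib that by (intro sum_strict_mono_ex1) auto
    then show False using sum sq cK card by simp
  qed
qed

section \<open>Sums of the additive character\<close>

lemma chi_add: "x \<in> K \<Longrightarrow> y \<in> K \<Longrightarrow> \<chi> (x + y) = \<chi> x * \<chi> y"
  using nontrivial_char by (simp add: nontrivial_char_def)

lemma chi_0 [simp]: "\<chi> 0 = 1"
  using chi_add[of 0 0] K_closed(1) nontrivial_char by (auto simp: nontrivial_char_def)

text \<open>Adding \<open>x\<close> to itself \<open>CHAR('a)\<close> times gives 0, so
  \<open>\<chi> x\<close> is a root of unity.\<close>

lemma norm_chi: assumes "x \<in> K" shows "cmod (\<chi> x) = 1"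
proof -
  have "of_nat m * x \<in> K \<and> \<chi> (of_nat m * x) = \<chi> x ^ m" for m
    using assms by (induction m) (auto simp: K_closed algebra_simps chi_add)
  from this[of "CHAR('a)"] have "\<chi> x ^ CHAR('a) = 1" by simp
  then show ?thesis using q_char_power(1) by (metis norm_one norm_power power_eq_1_iff prime_gt_0_nat norm_ge_zero power_eq_imp_eq_base power_one zero_le_one)
qed

lemma cnj_chi: "x \<in> K \<Longrightarrow> cnj (\<chi> x) = \<chi> (- x)"
proof -
  assume x: "x \<in> K"
  have "\<chi> x * \<chi> (-x) = 1" using chi_add[of x "-x"] x K_closed(4) by simp
  moreover have "\<chi> x * cnj (\<chi> x) = 1" using norm_chi[OF x] by (simp add: complex_norm_square[symmetric])
  ultimately show ?thesis by (metis mult_cancel_left mult_zero_left zero_neq_one)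
qed

lemma sum_chi_K:
  assumes "c \<in> K" "c \<noteq> 0"
  shows "(\<Sum>t\<in>K. \<chi> (c * t)) = 0"
proof -
  obtain a where a: "a \<in> K" "\<chi> a \<noteq> 1" using nontrivial_char by (auto simp: nontrivial_char_def)
  show ?thesis
  proof (rule sum_eq_0_if_shift)
    show "bij_betw (\<lambda>t. t + a / c) K K"
      by (rule bij_betwI[of _ _ _ "\<lambda>t. t - a / c"]) (use a assms K_closed in auto)
    show "\<chi> (c * (t + a / c)) = \<chi> a * \<chi> (c * t)" if "t \<in> K" for t
      using a assms K_closed that by (auto simp: chi_add[symmetric] distrib_left add.commute)
  qed (use a in auto)
qed

lemma sum_chi_K_nonzero:
  assumes "c \<in> K" "c \<noteq> 0"
  shows "(\<Sum>t\<in>K - {0}. \<chi> (c * t)) = -1"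
  using sum_chi_K[OF assms] K_closed(1) by (simp add: sum.remove[of K 0] eq_neg_iff_add_eq_0 add.commute)

text \<open>The Gauss sum in one variable: \<open>z = 0\<close> contributes 1, and each nonzero
  \<open>t\<close> in the subfield is a norm exactly \<open>q + 1\<close> times, giving
  \<open>1 - (q + 1)\<close>. The base \<open>-q\<close> of the Gaussian binomials comes from
  here.\<close>

lemma sum_chi_norm:
  assumes "c \<in> K" "c \<noteq> 0"
  shows "(\<Sum>z\<in>UNIV. \<chi> (c * (z * z ^ q))) = - of_nat q"
proof -
  have "(\<Sum>z\<in>UNIV - {0}. \<chi> (c * (z * z ^ q)))
      = (\<Sum>t\<in>K - {0}. \<Sum>z\<in>{z \<in> UNIV - {0}. z * z ^ q = t}. \<chi> (c * (z * z ^ q)))"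
    by (rule sum.group[symmetric]) (use norm_in_K in auto)
  also have "\<dots> = (\<Sum>t\<in>K - {0}. of_nat (q + 1) * \<chi> (c * t))"
  proof (rule sum.cong[OF refl])
    fix t assume t: "t \<in> K - {0}"
    have "{z \<in> UNIV - {0}. z * z ^ q = t} = {z. z * z ^ q = t}" using t by auto
    then have "card {z \<in> UNIV - {0}. z * z ^ q = t} = q + 1" using card_norm_fibre t by simp
    then show "(\<Sum>z\<in>{z \<in> UNIV - {0}. z * z ^ q = t}. \<chi> (c * (z * z ^ q))) = of_nat (q + 1) * \<chi> (c * t)"
      by simp
  qed
  also have "\<dots> = - of_nat (q + 1)"
    using sum_chi_K_nonzero[OF assms] by (simp add: sum_distrib_left[symmetric])
  finally show ?thesis by (simp add: sum.remove[of UNIV 0])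
qed

section \<open>Hermitian forms and kernels\<close>

abbreviation V :: "'a vec set" where "V \<equiv> carrier_vec n"
abbreviation H :: "'a mat set" where "H \<equiv> herm q n"

definition hip :: "'a vec \<Rightarrow> 'a vec \<Rightarrow> 'a" where
  "hip x y = (\<Sum>i<n. (x $ i) ^ q * y $ i)"

definition qform :: "'a mat \<Rightarrow> 'a vec \<Rightarrow> 'a" where
  "qform A x = hip x (A *\<^sub>v x)"

definition outer :: "'a vec \<Rightarrow> 'a mat" where
  "outer x = mat n n (\<lambda>(i, j). x $ i * (x $ j) ^ q)"

text \<open>This is the trace of \<open>A * B\<close>, which for Hermitian \<open>A\<close> is also
  that of \<open>A^* B\<close>. As an entry sum without conjugation it is visibly symmetric and
  bilinear.\<close>

definition trace_form :: "'a mat \<Rightarrow> 'a mat \<Rightarrow> 'a" where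
  "trace_form A B = (\<Sum>i<n. \<Sum>j<n. A $$ (i, j) * B $$ (j, i))"

lemma mult_mat_vec_index:
  "A \<in> carrier_mat n n \<Longrightarrow> x \<in> V \<Longrightarrow> i < n \<Longrightarrow> (A *\<^sub>v x) $ i = (\<Sum>j<n. A $$ (i, j) * x $ j)"
  by (auto simp: scalar_prod_def atLeast0LessThan)

lemma herm_iff:
  "A \<in> H \<longleftrightarrow> A \<in> carrier_mat n n \<and> (\<forall>i<n. \<forall>j<n. (A $$ (j, i)) ^ q = A $$ (i, j))"
proof -
  have "conj_transpose q A = A \<longleftrightarrow> (\<forall>i<n. \<forall>j<n. (A $$ (j, i)) ^ q = A $$ (i, j))"
    if "A \<in> carrier_mat n n"
    using that unfolding mat_eq_iff by (auto simp: conj_transpose_def conj_q_def)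
  then show ?thesis by (auto simp: herm_def)
qed

lemma herm_carrier: "A \<in> H \<Longrightarrow> A \<in> carrier_mat n n"
  by (simp add: herm_iff)

lemma herm_conj: "A \<in> H \<Longrightarrow> i < n \<Longrightarrow> j < n \<Longrightarrow> (A $$ (j, i)) ^ q = A $$ (i, j)"
  by (simp add: herm_iff)

lemma finite_herm: "finite H"
  using finite_carrier_mat by (rule finite_subset[rotated]) (auto simp: herm_iff)

lemma herm_closed:
  "0\<^sub>m n n \<in> H" "A \<in> H \<Longrightarrow> B \<in> H \<Longrightarrow> A + B \<in> H" "A \<in> H \<Longrightarrow> B \<in> H \<Longrightarrow> A - B \<in> H"
  "A \<in> H \<Longrightarrow> - A \<in> H" "A \<in> H \<Longrightarrow> k \<in> K \<Longrightarrow> k \<cdot>\<^sub>m A \<in> H"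
  by (auto simp: herm_iff conj_add conj_diff conj_minus power_mult_distrib K_iff)

lemma outer_herm: "outer x \<in> H"
  by (auto simp: herm_iff outer_def power_mult_distrib conj_conj mult.commute)

lemma hip_add_right: "y \<in> V \<Longrightarrow> z \<in> V \<Longrightarrow> hip x (y + z) = hip x y + hip x z"
  by (simp add: hip_def algebra_simps sum.distrib)

lemma hip_diff_right: "y \<in> V \<Longrightarrow> z \<in> V \<Longrightarrow> hip x (y - z) = hip x y - hip x z"
  by (simp add: hip_def algebra_simps sum_subtractf)

lemma hip_smult_right: "y \<in> V \<Longrightarrow> hip x (c \<cdot>\<^sub>v y) = c * hip x y"
  by (simp add: hip_def sum_distrib_left algebra_simps)

lemma hip_zero_right [simp]: "hip x (0\<^sub>v n) = 0"
  by (simp add: hip_def)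

lemma conj_hip: "(hip x y) ^ q = hip y x"
  by (simp add: hip_def conj_sum power_mult_distrib conj_conj mult.commute)

lemma hip_add_left: "y \<in> V \<Longrightarrow> z \<in> V \<Longrightarrow> hip (y + z) x = hip y x + hip z x"
  by (metis conj_add conj_hip hip_add_right)

lemma hip_smult_left: "y \<in> V \<Longrightarrow> hip (c \<cdot>\<^sub>v y) x = c ^ q * hip y x"
  by (metis conj_hip hip_smult_right power_mult_distrib)

lemma hip_unit: "i < n \<Longrightarrow> hip (unit_vec n i) y = y $ i"
  by (simp add: hip_def if_distrib if_distribR sum.delta cong: if_cong)

lemma hip_herm:
  assumes "A \<in> H" "x \<in> V" "y \<in> V"
  shows "hip x (A *\<^sub>v y) = hip (A *\<^sub>v x) y"
proof -
  have A: "A \<in> carrier_mat n n" using assms herm_carrier by auto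
  have "hip x (A *\<^sub>v y) = (\<Sum>i<n. \<Sum>j<n. (x $ i) ^ q * A $$ (i, j) * y $ j)"
    using A assms by (simp add: hip_def mult_mat_vec_index sum_distrib_left mult.assoc del: index_mult_mat_vec)
  also have "\<dots> = (\<Sum>j<n. \<Sum>i<n. (x $ i) ^ q * A $$ (i, j) * y $ j)" by (rule sum.swap)
  also have "\<dots> = (\<Sum>j<n. (\<Sum>i<n. A $$ (j, i) * x $ i) ^ q * y $ j)"
    using assms(1)
    by (intro sum.cong refl) (simp add: conj_sum sum_distrib_right sum_distrib_left power_mult_distrib herm_conj mult_ac)
  also have "\<dots> = hip (A *\<^sub>v x) y"
    using A assms by (simp add: hip_def mult_mat_vec_index del: index_mult_mat_vec)
  finally show ?thesis .
qed

lemma qform_in_K: "A \<in> H \<Longrightarrow> x \<in> V \<Longrightarrow> qform A x \<in> K"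
  unfolding K_iff qform_def by (metis conj_hip hip_herm)

lemma outer_mult_vec:
  assumes "x \<in> V" "y \<in> V"
  shows "outer x *\<^sub>v y = hip x y \<cdot>\<^sub>v x"
proof (rule eq_vecI)
  fix i assume "i < dim_vec (hip x y \<cdot>\<^sub>v x)"
  then have "i < n" using assms by simp
  then show "(outer x *\<^sub>v y) $ i = (hip x y \<cdot>\<^sub>v x) $ i"
    using assms herm_carrier[OF outer_herm]
    by (simp add: mult_mat_vec_index del: index_mult_mat_vec)
       (simp add: outer_def hip_def sum_distrib_left mult_ac)
qed (use assms in \<open>auto simp: outer_def\<close>)

text \<open>Polarization: if the form vanishes identically, every value \<open>z\<close> of
  \<open>hip x (A *\<^sub>v y)\<close> has trace 0. A single nonzero value could be scaled to any
  field element, contradicting \<open>exists_trace_nonzero\<close>. There is no division by 2, so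
  even \<open>q\<close> is covered.\<close>

lemma qform_exists_nonzero:
  assumes A: "A \<in> H" and ne: "A \<noteq> 0\<^sub>m n n"
  shows "\<exists>x\<in>V. qform A x \<noteq> 0"
proof (rule ccontr)
  assume "\<not> ?thesis"
  then have zero: "qform A x = 0" if "x \<in> V" for x using that by auto
  have Ac: "A \<in> carrier_mat n n" using A herm_carrier by auto
  have polar: "hip x (A *\<^sub>v y) + (hip x (A *\<^sub>v y)) ^ q = 0" if xy: "x \<in> V" "y \<in> V" for x y
  proof -
    have "qform A (x + y) = qform A x + hip x (A *\<^sub>v y) + hip y (A *\<^sub>v x) + qform A y"
      unfolding qform_def using xy Ac
      by (simp add: mult_add_distrib_mat_vec[OF Ac] hip_add_left hip_add_right add_ac)
    then show ?thesis using zero xy hip_herm[OF A] conj_hip by simp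
  qed
  have all0: "hip x (A *\<^sub>v y) = 0" if xy: "x \<in> V" "y \<in> V" for x y
  proof (rule ccontr)
    assume m: "hip x (A *\<^sub>v y) \<noteq> 0"
    have "z + z ^ q = 0" for z :: 'a
    proof -
      have "hip x (A *\<^sub>v ((z / hip x (A *\<^sub>v y)) \<cdot>\<^sub>v y)) = z"
        using m xy Ac by (simp add: mult_mat_vec hip_smult_right)
      then show ?thesis using polar[of x "(z / hip x (A *\<^sub>v y)) \<cdot>\<^sub>v y"] xy by simp
    qed
    then show False using exists_trace_nonzero by auto
  qed
  have "A $$ (i, j) = 0" if "i < n" "j < n" for i j
  proof -
    have "A $$ (i, j) = (A *\<^sub>v unit_vec n j) $ i"
      using that Ac by (simp add: scalar_prod_right_unit)
    also have "\<dots> = 0" using all0[of "unit_vec n i" "unit_vec n j"] that hip_unit by simp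
    finally show ?thesis .
  qed
  then have "A = 0\<^sub>m n n" using Ac by (intro eq_matI) auto
  with ne show False by simp
qed

section \<open>Kernels and nullity\<close>

definition ker :: "'a mat \<Rightarrow> 'a vec set" where
  "ker A = {v \<in> V. A *\<^sub>v v = 0\<^sub>v n}"

text \<open>Truncation does not occur for matrices of size \<open>n\<close>, by
  \<open>mrank_le\<close>; \<open>card_ker\<close> then identifies this number as the dimension of
  the kernel.\<close>

definition nul :: "'a mat \<Rightarrow> nat" where
  "nul A = n - mrank A"

lemma finite_V: "finite V"
  by (rule card_carrier_vec_finite)

lemma card_V: "card V = q ^ (2 * n)"
  by (simp add: card_carrier_vec_finite card_field power_mult)

lemma mrank_le: "A \<in> carrier_mat n n \<Longrightarrow> mrank A \<le> n"
  unfolding mrank_def by (auto intro: vec_space.rank_le_nc)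

lemma card_fibre:
  assumes A: "A \<in> carrier_mat n n" and v: "v \<in> V"
  shows "card {w \<in> V. A *\<^sub>v w = A *\<^sub>v v} = card (ker A)"
proof (rule bij_betw_same_card)
  show "bij_betw (\<lambda>w. w - v) {w \<in> V. A *\<^sub>v w = A *\<^sub>v v} (ker A)"
  proof (rule bij_betwI[of _ _ _ "\<lambda>w. w + v"])
    show "(\<lambda>w. w - v) \<in> {w \<in> V. A *\<^sub>v w = A *\<^sub>v v} \<rightarrow> ker A"
      using A v by (auto simp: ker_def mult_minus_distrib_mat_vec)
    show "(\<lambda>w. w + v) \<in> ker A \<rightarrow> {w \<in> V. A *\<^sub>v w = A *\<^sub>v v}"
      using A v by (auto simp: ker_def mult_add_distrib_mat_vec)
  qed (use v in \<open>auto simp: ker_def intro!: eq_vecI\<close>)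
qed

lemma sum_comp_mult_mat_vec:
  fixes f :: "'a vec \<Rightarrow> complex"
  assumes A: "A \<in> carrier_mat n n"
  shows "(\<Sum>v\<in>V. f (A *\<^sub>v v)) = of_nat (card (ker A)) * (\<Sum>x\<in>(\<lambda>v. A *\<^sub>v v) ` V. f x)"
proof -
  have "(\<Sum>v\<in>V. f (A *\<^sub>v v))
      = (\<Sum>x\<in>(\<lambda>v. A *\<^sub>v v) ` V. \<Sum>v\<in>{v \<in> V. A *\<^sub>v v = x}. f (A *\<^sub>v v))"
    by (rule sum.group[symmetric]) (use finite_V in auto)
  also have "\<dots> = (\<Sum>x\<in>(\<lambda>v. A *\<^sub>v v) ` V. of_nat (card (ker A)) * f x)"
    using card_fibre[OF A] by (intro sum.cong) auto
  finally show ?thesis by (simp add: sum_distrib_left)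
qed

lemma card_range_ker:
  assumes A: "A \<in> carrier_mat n n"
  shows "card ((\<lambda>v. A *\<^sub>v v) ` V) * card (ker A) = q ^ (2 * n)"
proof -
  have "complex_of_nat (card V) = of_nat (card ((\<lambda>v. A *\<^sub>v v) ` V) * card (ker A))"
    using sum_comp_mult_mat_vec[OF A, of "\<lambda>_. 1"] by (simp add: mult.commute)
  then show ?thesis by (simp only: of_nat_eq_iff card_V)
qed

lemma card_ker:
  assumes A: "A \<in> carrier_mat n n"
  shows "card (ker A) = q ^ (2 * nul A)"
proof -
  have "q ^ (2 * mrank A) * card (ker A) = q ^ (2 * n)"
    using card_range_ker[OF A] card_range_mult_mat_vec[OF A] by (simp add: card_field power_mult)
  also have "2 * n = 2 * mrank A + 2 * nul A" using mrank_le[OF A] by (simp add: nul_def)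
  finally show ?thesis using q_ge_2 by (simp add: power_add)
qed

lemma nul_cong:
  assumes "A \<in> carrier_mat n n" "B \<in> carrier_mat n n" "ker A = ker B"
  shows "nul A = nul B"
  using card_ker[OF assms(1)] card_ker[OF assms(2)] assms(3) q_ge_2 by simp

text \<open>The assumption on kernels says that \<open>ker A'\<close> is the direct sum of
  \<open>ker A\<close> and the line through \<open>x\<close>, so its cardinality is
  \<open>q ^ 2\<close> times as large. Rank changes thereby reduce to solving a linear
  equation.\<close>

lemma nul_Suc:
  assumes A: "A \<in> carrier_mat n n" and A': "A' \<in> carrier_mat n n" and x: "x \<in> V"
    and Ax: "A *\<^sub>v x \<noteq> 0\<^sub>v n"
    and ker: "\<And>y. y \<in> V \<Longrightarrow> A' *\<^sub>v y = 0\<^sub>v n \<longleftrightarrow> (\<exists>c. A *\<^sub>v y = c \<cdot>\<^sub>v (A *\<^sub>v x))"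
  shows "nul A' = Suc (nul A)"
proof -
  have eq: "ker A' = (\<lambda>(k, c). k + c \<cdot>\<^sub>v x) ` (ker A \<times> UNIV)"
  proof (intro subset_antisym subsetI)
    fix y assume y: "y \<in> ker A'"
    then have yV: "y \<in> V" by (simp add: ker_def)
    obtain c where c: "A *\<^sub>v y = c \<cdot>\<^sub>v (A *\<^sub>v x)" using y ker by (auto simp: ker_def)
    have "A *\<^sub>v (y - c \<cdot>\<^sub>v x) = 0\<^sub>v n"
      using A x yV c by (simp add: mult_minus_distrib_mat_vec mult_mat_vec)
    then have "y - c \<cdot>\<^sub>v x \<in> ker A" using yV x by (simp add: ker_def)
    moreover have "y = (y - c \<cdot>\<^sub>v x) + c \<cdot>\<^sub>v x" using yV x by auto
    ultimately show "y \<in> (\<lambda>(k, c). k + c \<cdot>\<^sub>v x) ` (ker A \<times> UNIV)"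
      by (intro image_eqI[of _ _ "(y - c \<cdot>\<^sub>v x, c)"]) (simp_all only: prod.case mem_Times_iff fst_conv snd_conv UNIV_I)
  next
    fix y assume "y \<in> (\<lambda>(k, c). k + c \<cdot>\<^sub>v x) ` (ker A \<times> UNIV)"
    then obtain k c where y: "y = k + c \<cdot>\<^sub>v x" "k \<in> ker A" by auto
    then have "A *\<^sub>v y = c \<cdot>\<^sub>v (A *\<^sub>v x)" using A x
      by (auto simp: ker_def mult_add_distrib_mat_vec mult_mat_vec)
    then show "y \<in> ker A'" using ker[of y] y x by (auto simp: ker_def)
  qed
  have "inj_on (\<lambda>(k, c). k + c \<cdot>\<^sub>v x) (ker A \<times> UNIV)"
  proof (rule inj_onI, clarsimp)
    fix k c k' c' assume k: "k \<in> ker A" "k' \<in> ker A" and e: "k + c \<cdot>\<^sub>v x = k' + c' \<cdot>\<^sub>v x"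
    have kV: "k \<in> V" "k' \<in> V" using k by (auto simp: ker_def)
    have *: "A *\<^sub>v (k + c \<cdot>\<^sub>v x) = c \<cdot>\<^sub>v (A *\<^sub>v x)" if "k \<in> ker A" for k c
      using A x that by (auto simp: ker_def mult_add_distrib_mat_vec mult_mat_vec)
    obtain i where i: "i < n" "(A *\<^sub>v x) $ i \<noteq> 0"
      using Ax A x by (metis carrier_matD(1) dim_mult_mat_vec eq_vecI index_zero_vec)
    have "c \<cdot>\<^sub>v (A *\<^sub>v x) = c' \<cdot>\<^sub>v (A *\<^sub>v x)" using *[OF k(1)] *[OF k(2)] e by metis
    then have "(c \<cdot>\<^sub>v (A *\<^sub>v x)) $ i = (c' \<cdot>\<^sub>v (A *\<^sub>v x)) $ i" by simp
    then have c: "c = c'" using i A by (simp del: index_mult_mat_vec)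
    have "k $ i = k' $ i" if "i < n" for i
      using arg_cong[OF e, of "\<lambda>v. v $ i"] that c kV x by simp
    then show "k = k' \<and> c = c'" using c kV by auto
  qed
  then have "card (ker A') = card (ker A) * q ^ 2"
    unfolding eq by (simp add: card_image card_cartesian_product card_field)
  then have "q ^ (2 * nul A') = q ^ (2 * Suc (nul A))"
    using card_ker[OF A] card_ker[OF A'] by (simp add: power_add[symmetric] power2_eq_square)
  then show ?thesis using q_ge_2 by (subst (asm) power_inject_exp) auto
qed

lemma nul_zero: "nul (0\<^sub>m n n) = n"
proof -
  have "ker (0\<^sub>m n n) = V" by (auto simp: ker_def)
  then have "q ^ (2 * nul (0\<^sub>m n n)) = q ^ (2 * n)" using card_ker[of "0\<^sub>m n n"] card_V by simp
  then show ?thesis using q_ge_2 by (subst (asm) power_inject_exp) auto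
qed

lemma nul_eq_n_iff:
  assumes A: "A \<in> carrier_mat n n"
  shows "nul A = n \<longleftrightarrow> A = 0\<^sub>m n n"
proof
  assume "nul A = n"
  then have "card (ker A) = card V" using card_ker[OF A] card_V by simp
  then have kV: "ker A = V" using finite_V by (intro card_subset_eq) (auto simp: ker_def)
  have "A $$ (i, j) = 0" if "i < n" "j < n" for i j
  proof -
    have u: "unit_vec n j \<in> ker A" unfolding kV by simp
    have "A $$ (i, j) = (A *\<^sub>v unit_vec n j) $ i"
      using that A by (simp add: scalar_prod_right_unit)
    also have "A *\<^sub>v unit_vec n j = 0\<^sub>v n" using u by (simp add: ker_def)
    finally show ?thesis using that by simp
  qed
  then show "A = 0\<^sub>m n n" using A by (intro eq_matI) auto
qed (simp add: nul_zero)

section \<open>Rank-one updates\<close>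

text \<open>The value of the one-variable Gauss sum \<open>sum_chi_norm\<close>.\<close>

definition b :: complex where "b = - of_nat q"

lemma b_nonzero [simp]: "b \<noteq> 0"
  using q_ge_2 by (simp add: b_def)

lemma b_even_power: "of_nat (q ^ (2 * m)) = b ^ (2 * m)"
  by (simp add: b_def power_mult)

lemma bij_add_V: "v \<in> V \<Longrightarrow> bij_betw (\<lambda>x. x + v) V V"
  by (rule bij_betwI[of _ _ _ "\<lambda>x. x - v"]) auto

text \<open>The trace is linear over the subfield and not zero, so it takes a value at which
  \<open>\<chi>\<close> is not 1.\<close>

lemma exists_chi_trace: "\<exists>a. \<chi> (a + a ^ q) \<noteq> 1"
proof -
  obtain z :: 'a where z: "z + z ^ q \<noteq> 0" using exists_trace_nonzero by auto
  obtain t where t: "t \<in> K" "\<chi> t \<noteq> 1" using nontrivial_char by (auto simp: nontrivial_char_def)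
  define k where "k = t / (z + z ^ q)"
  have "k ^ q = k" using K_closed(7)[OF t(1) trace_in_K[of z]] by (simp add: k_def K_iff)
  then have "k * z + (k * z) ^ q = k * (z + z ^ q)" by (simp add: power_mult_distrib distrib_left)
  then show ?thesis using t z by (intro exI[of _ "k * z"]) (simp add: k_def)
qed

text \<open>The orthogonal complement \<open>P\<close> of the kernel contains the range because
  \<open>B\<close> is self-adjoint. Both sets have the same size: a double sum of characters gives
  \<open>card P * card (ker B) = card V\<close>, which is also the product for the range.\<close>

lemma mem_range_if_perp_ker:
  assumes B: "B \<in> H" and x: "x \<in> V" and perp: "\<And>w. w \<in> ker B \<Longrightarrow> hip x w = 0"
  shows "x \<in> (\<lambda>v. B *\<^sub>v v) ` V"
proof -
  \<comment> \<open>Values of \<open>hip\<close> need not lie in the subfield, so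
    \<open>\<chi>\<close> is composed with the trace to get a nontrivial character of the whole
    field.\<close>
  define \<psi> where "\<psi> a = \<chi> (a + a ^ q)" for a
  have psi_add: "\<psi> (s + t) = \<psi> t * \<psi> s" for s t
    using chi_add[OF trace_in_K trace_in_K, of t s] by (simp add: \<psi>_def conj_add add_ac)
  have psi_0: "\<psi> 0 = 1" by (simp add: \<psi>_def)
  obtain a where a: "\<psi> a \<noteq> 1" using exists_chi_trace by (auto simp: \<psi>_def)
  have Bc: "B \<in> carrier_mat n n" using B herm_carrier by auto
  have fk: "finite (ker B)" using finite_V by (auto simp: ker_def)
  define P where "P = {x \<in> V. \<forall>w\<in>ker B. hip x w = 0}"
  have s1: "(\<Sum>x\<in>V. \<psi> (hip x w)) = (if w = 0\<^sub>v n then of_nat (card V) else 0)" if w: "w \<in> V" for w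
  proof (cases "w = 0\<^sub>v n")
    case True
    then show ?thesis by (simp add: psi_0)
  next
    case False
    then obtain i where i: "i < n" "w $ i \<noteq> 0"
      using w by (metis carrier_vecD eq_vecI index_zero_vec)
    \<comment> \<open>The coefficient is conjugated because \<open>hip\<close> is conjugate-linear
      in its first argument; this makes \<open>hip v w = a\<close>.\<close>
    define v where "v = ((a / w $ i) ^ q) \<cdot>\<^sub>v unit_vec n i"
    have v: "v \<in> V" by (simp add: v_def)
    have hv: "hip v w = a" using i by (simp add: v_def hip_smult_left hip_unit conj_conj)
    have "(\<Sum>x\<in>V. \<psi> (hip x w)) = 0"
      by (rule sum_eq_0_if_shift[OF bij_add_V[OF v] _ a])
         (use v hv in \<open>auto simp: hip_add_left psi_add\<close>)
    then show ?thesis using False by simp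
  qed
  have s2: "(\<Sum>w\<in>ker B. \<psi> (hip x w)) = (if x \<in> P then of_nat (card (ker B)) else 0)" if xV: "x \<in> V" for x
  proof (cases "x \<in> P")
    case True
    then have "(\<Sum>w\<in>ker B. \<psi> (hip x w)) = (\<Sum>w\<in>ker B. 1)" by (intro sum.cong) (auto simp: P_def psi_0)
    then show ?thesis using True by simp
  next
    case False
    then obtain w0 where w0: "w0 \<in> ker B" "hip x w0 \<noteq> 0" using xV by (auto simp: P_def)
    define v where "v = (a / hip x w0) \<cdot>\<^sub>v w0"
    have v: "v \<in> V" "B *\<^sub>v v = 0\<^sub>v n" using w0 Bc by (auto simp: v_def ker_def mult_mat_vec)
    have hv: "hip x v = a" using w0 by (simp add: v_def hip_smult_right ker_def)
    have "bij_betw (\<lambda>w. w + v) (ker B) (ker B)"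
      by (rule bij_betwI[of _ _ _ "\<lambda>w. w - v"])
         (use v Bc in \<open>auto simp: ker_def mult_add_distrib_mat_vec mult_minus_distrib_mat_vec\<close>)
    then have "(\<Sum>w\<in>ker B. \<psi> (hip x w)) = 0"
      by (rule sum_eq_0_if_shift[OF _ _ a])
         (use v hv in \<open>auto simp: hip_add_right psi_add ker_def\<close>)
    then show ?thesis using False by simp
  qed
  have z: "0\<^sub>v n \<in> ker B" using Bc by (auto simp: ker_def)
  \<comment> \<open>Summing over \<open>x\<close> first leaves only \<open>w = 0\<close>; summing
    over \<open>w\<close> first leaves only \<open>x\<close> in \<open>P\<close>.\<close>
  have "(\<Sum>w\<in>ker B. \<Sum>x\<in>V. \<psi> (hip x w)) = (\<Sum>w\<in>ker B. if w = 0\<^sub>v n then of_nat (card V) else 0)"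
    using s1 by (intro sum.cong) (auto simp: ker_def)
  also have "\<dots> = of_nat (card V)" using z fk by simp
  finally have "of_nat (card V) = (\<Sum>x\<in>V. \<Sum>w\<in>ker B. \<psi> (hip x w))" by (subst sum.swap) simp
  also have "\<dots> = (\<Sum>x\<in>V. if x \<in> P then of_nat (card (ker B)) else 0)"
    using s2 by (intro sum.cong) auto
  also have "\<dots> = (\<Sum>x\<in>P. of_nat (card (ker B)))"
    using finite_V by (intro sum.mono_neutral_cong_right) (auto simp: P_def)
  also have "\<dots> = of_nat (card P * card (ker B))" by simp
  finally have "card V = card P * card (ker B)" by (simp only: of_nat_eq_iff)
  then have "card P * card (ker B) = card ((\<lambda>v. B *\<^sub>v v) ` V) * card (ker B)"
    using card_range_ker[OF Bc] card_V by linarith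
  moreover have "card (ker B) \<noteq> 0" using z fk by auto
  ultimately have c: "card P = card ((\<lambda>v. B *\<^sub>v v) ` V)" by simp
  have "(\<lambda>v. B *\<^sub>v v) ` V \<subseteq> P"
  proof
    fix y assume "y \<in> (\<lambda>v. B *\<^sub>v v) ` V"
    then obtain v where v: "v \<in> V" "y = B *\<^sub>v v" by auto
    have "hip y w = 0" if "w \<in> ker B" for w
      using hip_herm[OF B v(1), of w] that v by (simp add: ker_def)
    then show "y \<in> P" using v Bc by (auto simp: P_def)
  qed
  then have "(\<lambda>v. B *\<^sub>v v) ` V = P" using c finite_V by (intro card_subset_eq) (auto simp: P_def)
  then show ?thesis using x perp by (auto simp: P_def)
qed

lemma add_outer_mult_vec:
  assumes "B \<in> H" "x \<in> V" "y \<in> V"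
  shows "(B + outer x) *\<^sub>v y = B *\<^sub>v y + hip x y \<cdot>\<^sub>v x"
  using assms herm_carrier[OF outer_herm[of x]] herm_carrier[of B]
  by (simp add: add_mult_distrib_mat_vec outer_mult_vec)

lemma add_smult_eq_0_iff:
  fixes v w :: "'a vec"
  assumes "v \<in> V" "w \<in> V"
  shows "v + c \<cdot>\<^sub>v w = 0\<^sub>v n \<longleftrightarrow> v = (- c) \<cdot>\<^sub>v w"
  using assms by (auto simp: vec_eq_iff eq_neg_iff_add_eq_0)

lemma smult_self_eq_0:
  fixes c :: 'a
  assumes "c \<cdot>\<^sub>v w = 0\<^sub>v n" "w \<in> V" "w \<noteq> 0\<^sub>v n"
  shows "c = 0"
  using assms by (auto simp: vec_eq_iff)

text \<open>Some \<open>w\<close> in the kernel of \<open>B\<close> is not orthogonal to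
  \<open>x\<close>, and the update sends it to a nonzero multiple of \<open>x\<close>. If the update
  sends \<open>y\<close> to a multiple of \<open>x\<close>, then so does \<open>B\<close>, which
  forces \<open>B y = 0\<close> as \<open>x\<close> is not in the range. So \<open>nul_Suc\<close>
  applies with \<open>B\<close> in the role of the larger kernel.\<close>

lemma nul_add_outer_notin_range:
  assumes B: "B \<in> H" and x: "x \<in> V" and nr: "x \<notin> (\<lambda>v. B *\<^sub>v v) ` V"
  shows "nul B = Suc (nul (B + outer x))"
proof -
  have Bc: "B \<in> carrier_mat n n" using B herm_carrier by auto
  have B'c: "B + outer x \<in> carrier_mat n n" by (rule herm_carrier[OF herm_closed(2)[OF B outer_herm]])
  obtain w where w: "w \<in> ker B" "hip x w \<noteq> 0" using mem_range_if_perp_ker[OF B x] nr by auto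
  then have wV: "w \<in> V" "B *\<^sub>v w = 0\<^sub>v n" by (auto simp: ker_def)
  have x0: "x \<noteq> 0\<^sub>v n"
  proof
    assume "x = 0\<^sub>v n"
    moreover have "B *\<^sub>v 0\<^sub>v n = 0\<^sub>v n" using Bc by auto
    ultimately show False using nr by (metis image_eqI zero_carrier_vec)
  qed
  have B'w: "(B + outer x) *\<^sub>v w = hip x w \<cdot>\<^sub>v x"
    using add_outer_mult_vec[OF B x wV(1)] wV x by simp
  show ?thesis
  proof (rule nul_Suc[OF B'c Bc wV(1)])
    show "(B + outer x) *\<^sub>v w \<noteq> 0\<^sub>v n"
      unfolding B'w using smult_self_eq_0[of "hip x w" x] w x x0 by auto
    fix y assume y: "y \<in> V"
    have By: "B *\<^sub>v y \<in> V" using Bc y by auto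
    show "B *\<^sub>v y = 0\<^sub>v n \<longleftrightarrow> (\<exists>c. (B + outer x) *\<^sub>v y = c \<cdot>\<^sub>v ((B + outer x) *\<^sub>v w))"
    proof
      assume "B *\<^sub>v y = 0\<^sub>v n"
      then have "(B + outer x) *\<^sub>v y = (hip x y / hip x w) \<cdot>\<^sub>v ((B + outer x) *\<^sub>v w)"
        using add_outer_mult_vec[OF B x y] B'w x w by (simp add: smult_smult_assoc)
      then show "\<exists>c. (B + outer x) *\<^sub>v y = c \<cdot>\<^sub>v ((B + outer x) *\<^sub>v w)" by blast
    next
      assume "\<exists>c. (B + outer x) *\<^sub>v y = c \<cdot>\<^sub>v ((B + outer x) *\<^sub>v w)"
      then obtain c where "B *\<^sub>v y + hip x y \<cdot>\<^sub>v x = (c * hip x w) \<cdot>\<^sub>v x"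
        using add_outer_mult_vec[OF B x y] B'w by (auto simp: smult_smult_assoc)
      then have e: "B *\<^sub>v y = (c * hip x w - hip x y) \<cdot>\<^sub>v x" (is "_ = ?d \<cdot>\<^sub>v x")
        using By x Bc by (auto simp: vec_eq_iff algebra_simps eq_diff_eq)
      have "?d = 0"
      proof (rule ccontr)
        assume d: "?d \<noteq> 0"
        then have "B *\<^sub>v ((1 / ?d) \<cdot>\<^sub>v y) = x"
          using Bc y x by (simp add: mult_mat_vec e smult_smult_assoc)
        then show False using nr y by (metis image_eqI smult_carrier_vec)
      qed
      then show "B *\<^sub>v y = 0\<^sub>v n" using e x by auto
    qed
  qed
qed

text \<open>A vector \<open>y\<close> killed by the update satisfies \<open>B y = - h B z\<close>
  with \<open>h = hip z (B y)\<close>; pairing with \<open>z\<close> gives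
  \<open>h * (1 + qform B z) = 0\<close>. Only the form value -1 allows a nonzero \<open>h\<close>,
  that is, new kernel vectors.\<close>

lemma nul_add_outer_in_range:
  assumes B: "B \<in> H" and z: "z \<in> V"
  shows "nul (B + outer (B *\<^sub>v z)) = (if qform B z = -1 then Suc (nul B) else nul B)"
proof -
  have Bc: "B \<in> carrier_mat n n" using B herm_carrier by auto
  have x: "B *\<^sub>v z \<in> V" using Bc z by auto
  have B'c: "B + outer (B *\<^sub>v z) \<in> carrier_mat n n" by (rule herm_carrier[OF herm_closed(2)[OF B outer_herm]])
  have B': "(B + outer (B *\<^sub>v z)) *\<^sub>v y = 0\<^sub>v n \<longleftrightarrow> B *\<^sub>v y = (- hip z (B *\<^sub>v y)) \<cdot>\<^sub>v (B *\<^sub>v z)"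
    if "y \<in> V" for y
    using add_outer_mult_vec[OF B x that] hip_herm[OF B z that] add_smult_eq_0_iff[OF _ x] Bc that by simp
  have hipc: "hip z (B *\<^sub>v y) = c * qform B z" if "B *\<^sub>v y = c \<cdot>\<^sub>v (B *\<^sub>v z)" for c y
    using that x by (simp add: hip_smult_right qform_def)
  show ?thesis
  proof (cases "qform B z = -1")
    case True
    have "nul (B + outer (B *\<^sub>v z)) = Suc (nul B)"
    proof (rule nul_Suc[OF Bc B'c z])
      show "B *\<^sub>v z \<noteq> 0\<^sub>v n" using True by (auto simp: qform_def)
      fix y assume "y \<in> V"
      show "(B + outer (B *\<^sub>v z)) *\<^sub>v y = 0\<^sub>v n \<longleftrightarrow> (\<exists>c. B *\<^sub>v y = c \<cdot>\<^sub>v (B *\<^sub>v z))"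
        unfolding B'[OF \<open>y \<in> V\<close>] using hipc True by auto
    qed
    then show ?thesis using True by simp
  next
    case False
    have z0: "0 \<cdot>\<^sub>v (B *\<^sub>v z) = 0\<^sub>v n" using x Bc by (intro eq_vecI) auto
    have "ker (B + outer (B *\<^sub>v z)) = ker B"
    proof -
      have "B *\<^sub>v y = 0\<^sub>v n" if "B *\<^sub>v y = (- hip z (B *\<^sub>v y)) \<cdot>\<^sub>v (B *\<^sub>v z)" for y
      proof -
        have "hip z (B *\<^sub>v y) * (1 + qform B z) = 0" using hipc[OF that]
          by (metis add.commute add_eq_0_iff distrib_left mult.right_neutral mult_minus_left)
        moreover have "1 + qform B z \<noteq> 0" using False by (metis add_eq_0_iff)
        ultimately have "hip z (B *\<^sub>v y) = 0" by simp
        then show ?thesis using that z0 by simp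
      qed
      then show ?thesis using B' z0 by (auto simp: ker_def)
    qed
    then show ?thesis using False nul_cong[OF B'c Bc] by simp
  qed
qed

section \<open>Gauss sums\<close>

lemma smult_mat_mult_vec:
  assumes "A \<in> carrier_mat n n" "y \<in> V"
  shows "(t \<cdot>\<^sub>m A) *\<^sub>v y = t \<cdot>\<^sub>v (A *\<^sub>v y)"
  using assms by (intro eq_vecI) (auto simp: scalar_prod_def sum_distrib_left mult.assoc)

lemma qform_smult:
  assumes "A \<in> carrier_mat n n" "y \<in> V"
  shows "qform (t \<cdot>\<^sub>m A) y = t * qform A y"
  using assms by (simp add: qform_def smult_mat_mult_vec hip_smult_right)

lemma nul_smult:
  assumes A: "A \<in> carrier_mat n n" and t: "t \<noteq> 0"
  shows "nul (t \<cdot>\<^sub>m A) = nul A"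
proof (rule nul_cong)
  have "t \<cdot>\<^sub>v w = 0\<^sub>v n \<longleftrightarrow> w = 0\<^sub>v n" if "w \<in> V" for w
    using that t smult_self_eq_0[of t w] by auto
  then show "ker (t \<cdot>\<^sub>m A) = ker A"
    using A by (auto simp: ker_def smult_mat_mult_vec)
qed (use A in auto)

lemma qform_add_ker:
  assumes A: "A \<in> H" and y: "y \<in> V" and x: "x \<in> ker A"
  shows "qform A (y + x) = qform A y"
proof -
  have xV: "x \<in> V" "A *\<^sub>v x = 0\<^sub>v n" using x by (auto simp: ker_def)
  have Ac: "A \<in> carrier_mat n n" using A herm_carrier by auto
  have "A *\<^sub>v (y + x) = A *\<^sub>v y" using mult_add_distrib_mat_vec[OF Ac y xV(1)] xV Ac y by simp
  moreover have "hip x (A *\<^sub>v y) = 0"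
    using hip_herm[OF A xV(1) y] xV conj_hip[of y "0\<^sub>v n"] by simp
  ultimately show ?thesis using Ac y xV by (simp add: qform_def hip_add_left)
qed

text \<open>Splitting off a non-isotropic vector \<open>x\<close> replaces \<open>A\<close> by the form \<open>A - (A x)(A x)\<^sup>* / c\<close>
  with \<open>c = x\<^sup>* A x\<close>, of rank one less, and contributes a factor \<open>- 1 / q\<close>.\<close>
lemma gauss_sum:
  assumes "A \<in> H"
  shows "(\<Sum>y\<in>V. \<chi> (qform A y)) = b ^ n * b ^ nul A"
  using assms
proof (induction "mrank A" arbitrary: A rule: less_induct)
  case less
  note A = less.prems
  have Ac: "A \<in> carrier_mat n n" using A herm_carrier by auto
  show ?case
  proof (cases "A = 0\<^sub>m n n")
    case True
    have "qform A y = 0" if "y \<in> V" for y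
    proof -
      have "A *\<^sub>v y = 0\<^sub>v n" using that True by (intro eq_vecI) auto
      then show ?thesis by (simp add: qform_def)
    qed
    then have "(\<Sum>y\<in>V. \<chi> (qform A y)) = of_nat (q ^ (2 * n))" by (simp add: card_V)
    then show ?thesis unfolding b_even_power using True by (simp add: nul_zero mult_2 power_add)
  next
    case False
    then obtain x where x: "x \<in> V" "qform A x \<noteq> 0" using qform_exists_nonzero[OF A] by auto
    define c where "c = qform A x"
    have c: "c \<in> K" "c \<noteq> 0" using qform_in_K[OF A x(1)] x(2) by (auto simp: c_def)
    define w where "w = A *\<^sub>v x"
    have w: "w \<in> V" using Ac x by (auto simp: w_def)
    define A' where "A' = A - (1 / c) \<cdot>\<^sub>m outer w"
    have A': "A' \<in> H" unfolding A'_def using A c outer_herm K_closed by (intro herm_closed) auto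
    have A'c: "A' \<in> carrier_mat n n" using A' herm_carrier by auto
    have oc: "outer w \<in> carrier_mat n n" using herm_carrier outer_herm by blast
    have A'y: "A' *\<^sub>v y = A *\<^sub>v y - (hip w y / c) \<cdot>\<^sub>v w" if "y \<in> V" for y
      using that Ac oc w unfolding A'_def
      by (simp add: minus_mult_distrib_mat_vec smult_mat_mult_vec outer_mult_vec smult_smult_assoc)
    have hw: "hip w y = hip x (A *\<^sub>v y)" if "y \<in> V" for y
      using hip_herm[OF A x(1) that] by (simp add: w_def)
    have hwx: "hip w x = c" using hw[OF x(1)] by (simp add: c_def qform_def)
    have w0: "w \<noteq> 0\<^sub>v n" using x(2) by (auto simp: qform_def w_def)
    have "nul A' = Suc (nul A)"
    proof (rule nul_Suc[OF Ac A'c x(1)])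
      show "A *\<^sub>v x \<noteq> 0\<^sub>v n" using w0 by (simp add: w_def)
      fix y assume y: "y \<in> V"
      show "A' *\<^sub>v y = 0\<^sub>v n \<longleftrightarrow> (\<exists>c. A *\<^sub>v y = c \<cdot>\<^sub>v (A *\<^sub>v x))"
      proof
        assume "A' *\<^sub>v y = 0\<^sub>v n"
        then have "A *\<^sub>v y = (hip w y / c) \<cdot>\<^sub>v w"
          unfolding A'y[OF y] using w Ac y by (auto simp: vec_eq_iff)
        then show "\<exists>c. A *\<^sub>v y = c \<cdot>\<^sub>v (A *\<^sub>v x)" unfolding w_def by blast
      next
        assume "\<exists>c. A *\<^sub>v y = c \<cdot>\<^sub>v (A *\<^sub>v x)"
        then obtain d where d: "A *\<^sub>v y = d \<cdot>\<^sub>v w" by (auto simp: w_def)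
        have "hip w y = d * c"
          using hw[OF y] d w x(1) by (simp add: hip_smult_right c_def qform_def w_def)
        then show "A' *\<^sub>v y = 0\<^sub>v n" unfolding A'y[OF y] d using c w by simp
      qed
    qed
    moreover have "nul A' \<le> n" by (simp add: nul_def)
    ultimately have nul: "nul A' = Suc (nul A)" and rk: "mrank A' < mrank A"
      by (auto simp: nul_def)
    \<comment> \<open>The vector \<open>x\<close> spans the new kernel direction, so translating by
      its multiples leaves \<open>qform A'\<close> unchanged.\<close>
    have kx: "l \<cdot>\<^sub>v x \<in> ker A'" for l
    proof -
      have "A' *\<^sub>v x = 0\<^sub>v n" unfolding A'y[OF x(1)] using hwx c w by (simp add: w_def[symmetric])
      then show ?thesis using x A'c by (auto simp: ker_def mult_mat_vec)
    qed
    have qA: "qform A y = qform A' y + (1 / c) * (hip w y * hip w y ^ q)" if y: "y \<in> V" for y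
    proof -
      have "qform A' y = qform A y - (hip w y / c) * hip y w"
        using y w Ac unfolding qform_def A'y[OF y] by (simp add: hip_diff_right hip_smult_right)
      then show ?thesis by (simp add: conj_hip)
    qed
    have shift: "\<chi> (qform A (y + l \<cdot>\<^sub>v x))
        = \<chi> (qform A' y) * \<chi> ((1 / c) * ((hip w y + l * c) * (hip w y + l * c) ^ q))"
      if y: "y \<in> V" for y l
    proof -
      have "qform A (y + l \<cdot>\<^sub>v x)
          = qform A' y + (1 / c) * ((hip w y + l * c) * (hip w y + l * c) ^ q)"
        using y x qA[of "y + l \<cdot>\<^sub>v x"] qform_add_ker[OF A' y kx[of l]]
        by (simp add: hip_add_right hip_smult_right hwx)
      then show ?thesis
        using chi_add[OF qform_in_K[OF A' y]] K_closed(6,7) K_closed(2) c norm_in_K by metis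
    qed
    have inner: "(\<Sum>l\<in>UNIV. \<chi> ((1 / c) * ((m + l * c) * (m + l * c) ^ q))) = b" for m
    proof -
      have "(\<Sum>l\<in>UNIV. \<chi> ((1 / c) * ((m + l * c) * (m + l * c) ^ q)))
          = (\<Sum>z\<in>UNIV. \<chi> ((1 / c) * (z * z ^ q)))"
        by (rule sum.reindex_bij_witness[of _ "\<lambda>z. (z - m) / c" "\<lambda>l. m + l * c"]) (use c in auto)
      then show ?thesis using sum_chi_norm[of "1 / c"] c K_closed by (simp add: b_def)
    qed
    \<comment> \<open>The sum is averaged over the \<open>q ^ 2\<close> translations by multiples of
      \<open>x\<close>; after exchanging the sums, each inner sum over \<open>l\<close> is a
      one-variable Gauss sum equal to \<open>b\<close>.\<close>
    have "of_nat (q ^ (2 * 1)) * (\<Sum>y\<in>V. \<chi> (qform A y)) = (\<Sum>l\<in>(UNIV :: 'a set). \<Sum>y\<in>V. \<chi> (qform A y))"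
      by (simp add: card_field)
    also have "\<dots> = (\<Sum>l\<in>UNIV. \<Sum>y\<in>V. \<chi> (qform A (y + l \<cdot>\<^sub>v x)))"
    proof (rule sum.cong[OF refl])
      fix l :: 'a
      have "l \<cdot>\<^sub>v x \<in> V" using x by simp
      from sum.reindex_bij_betw[OF bij_add_V[OF this], of "\<lambda>y. \<chi> (qform A y)"]
      show "(\<Sum>y\<in>V. \<chi> (qform A y)) = (\<Sum>y\<in>V. \<chi> (qform A (y + l \<cdot>\<^sub>v x)))" by simp
    qed
    also have "\<dots> = (\<Sum>y\<in>V. \<Sum>l\<in>UNIV. \<chi> (qform A (y + l \<cdot>\<^sub>v x)))" by (rule sum.swap)
    also have "\<dots> = (\<Sum>y\<in>V. \<chi> (qform A' y) * b)"
      using shift inner by (intro sum.cong) (auto simp: sum_distrib_left[symmetric])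
    also have "\<dots> = b ^ n * b ^ Suc (nul A) * b"
      using less.hyps[OF rk A'] nul by (simp add: sum_distrib_right[symmetric])
    finally have "b ^ 2 * (\<Sum>y\<in>V. \<chi> (qform A y)) = b ^ 2 * (b ^ n * b ^ nul A)"
      unfolding b_even_power by (simp add: power2_eq_square)
    then show ?thesis by simp
  qed
qed

text \<open>The condition is detected by a character sum over the subfield. There
  \<open>t = 0\<close> contributes \<open>b ^ (2 * n)\<close>, and each other \<open>t\<close>
  contributes \<open>\<chi> t\<close> times the Gauss sum of a scaled form of equal nullity; these
  \<open>\<chi> t\<close> sum to -1. The factor \<open>- b\<close> is \<open>q\<close>.\<close>

lemma card_qform_eq_minus_one:
  assumes B: "B \<in> H"
  shows "- b * of_nat (card {y \<in> V. qform B y = -1}) = b ^ (2 * n) - b ^ n * b ^ nul B"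
proof -
  have Bc: "B \<in> carrier_mat n n" using B herm_carrier by auto
  have "(\<Sum>y\<in>V. \<Sum>t\<in>K. \<chi> ((qform B y + 1) * t))
      = (\<Sum>y\<in>V. if qform B y = -1 then of_nat q else 0)"
  proof (rule sum.cong[OF refl])
    fix y assume y: "y \<in> V"
    show "(\<Sum>t\<in>K. \<chi> ((qform B y + 1) * t)) = (if qform B y = -1 then of_nat q else 0)"
    proof (cases "qform B y = -1")
      case True
      then show ?thesis by (simp add: card_K)
    next
      case False
      then have "qform B y + 1 \<noteq> 0" by (metis add_eq_0_iff2)
      then show ?thesis using False sum_chi_K[of "qform B y + 1"] qform_in_K[OF B y] K_closed by simp
    qed
  qed
  also have "\<dots> = of_nat (card {y \<in> V. qform B y = -1}) * of_nat q"
    using finite_V by (simp add: sum.If_cases Int_def)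
  finally have 1: "- b * of_nat (card {y \<in> V. qform B y = -1}) = (\<Sum>t\<in>K. \<Sum>y\<in>V. \<chi> ((qform B y + 1) * t))"
    by (subst sum.swap) (simp add: b_def mult.commute)
  have "(\<Sum>y\<in>V. \<chi> ((qform B y + 1) * t)) = b ^ n * b ^ nul B * \<chi> t" if t: "t \<in> K" "t \<noteq> 0" for t
  proof -
    have tB: "t \<cdot>\<^sub>m B \<in> H" using B t by (intro herm_closed)
    have "(\<Sum>y\<in>V. \<chi> ((qform B y + 1) * t)) = (\<Sum>y\<in>V. \<chi> (qform (t \<cdot>\<^sub>m B) y) * \<chi> t)"
    proof (rule sum.cong[OF refl])
      fix y assume y: "y \<in> V"
      show "\<chi> ((qform B y + 1) * t) = \<chi> (qform (t \<cdot>\<^sub>m B) y) * \<chi> t"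
        using chi_add[OF qform_in_K[OF tB y] t(1)] qform_smult[OF Bc y, of t]
        by (simp add: algebra_simps)
    qed
    then show ?thesis using gauss_sum[OF tB] nul_smult[OF Bc t(2)] by (simp add: sum_distrib_right[symmetric])
  qed
  then have "(\<Sum>t\<in>K - {0}. \<Sum>y\<in>V. \<chi> ((qform B y + 1) * t)) = (\<Sum>t\<in>K - {0}. b ^ n * b ^ nul B * \<chi> t)"
    by (intro sum.cong) auto
  also have "\<dots> = - (b ^ n * b ^ nul B)"
    using sum_chi_K_nonzero[OF K_closed(2)] by (simp add: sum_distrib_left[symmetric])
  finally have "(\<Sum>t\<in>K - {0}. \<Sum>y\<in>V. \<chi> ((qform B y + 1) * t)) = - (b ^ n * b ^ nul B)" .
  moreover have "(\<Sum>y\<in>V. \<chi> ((qform B y + 1) * 0)) = b ^ (2 * n)"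
    using b_even_power[of n] by (simp add: card_V)
  ultimately show ?thesis unfolding 1 using K_closed(1)
    by (subst sum.remove[of K 0]) auto
qed

text \<open>Vectors \<open>x\<close> outside the range lower the nullity. Those inside raise it when
  \<open>x = B y\<close> with \<open>qform B y = -1\<close>, and keep it otherwise. \<open>M\<close>
  is the number of raising vectors; if the nullity is 0, the weight of the truncated
  \<open>nul B - 1\<close> is 0.\<close>

lemma sum_nul_add_outer:
  assumes B: "B \<in> H"
  obtains M where "b * M = - (b ^ (n - nul B) * (b ^ (n - nul B) - 1))"
    "\<And>g. (\<Sum>x\<in>V. g (nul (B + outer x))) = (b ^ (2 * n) - b ^ (2 * (n - nul B))) * g (nul B - 1)
      + M * g (nul B + 1) + (b ^ (2 * (n - nul B)) - M) * g (nul B)"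
proof -
  have Bc: "B \<in> carrier_mat n n" using B herm_carrier by auto
  define u where "u = nul B"
  define i where "i = n - u"
  have n: "n = i + u" unfolding i_def u_def by (simp add: nul_def)
  define R where "R = (\<lambda>v. B *\<^sub>v v) ` V"
  have R: "R \<subseteq> V" "finite R" using Bc finite_V by (auto simp: R_def)
  define N :: complex where "N = of_nat (card {y \<in> V. qform B y = -1})"
  \<comment> \<open>\<open>N\<close> counts preimages \<open>y\<close>, and each \<open>x\<close> in
    the range has \<open>b ^ (2 * u)\<close> of them.\<close>
  define M where "M = N / b ^ (2 * u)"
  have N: "b * N = - (b ^ (2 * n) - b ^ n * b ^ u)"
    using card_qform_eq_minus_one[OF B] unfolding N_def u_def by (metis minus_mult_left minus_minus)
  have NM: "N = b ^ (2 * u) * M" by (simp add: M_def)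
  have "b ^ (2 * u) * (b * M) = b ^ (2 * u) * (- (b ^ i * (b ^ i - 1)))"
    using N unfolding NM n by (simp add: algebra_simps power_add mult_2 mult_2_right)
  then have M: "b * M = - (b ^ i * (b ^ i - 1))"
    by (metis b_nonzero mult_left_cancel power_not_zero)
  have cR: "of_nat (card R) = b ^ (2 * i)"
  proof -
    have "of_nat (card R) * of_nat (q ^ (2 * u)) = complex_of_nat (q ^ (2 * n))"
      using card_range_ker[OF Bc] card_ker[OF Bc] unfolding R_def u_def by (metis of_nat_mult)
    then have "of_nat (card R) * b ^ (2 * u) = b ^ (2 * i) * b ^ (2 * u)"
      unfolding b_even_power n by (simp add: power_add)
    then show ?thesis by (metis b_nonzero mult_right_cancel power_not_zero)
  qed
  have sum: "(\<Sum>x\<in>V. g (nul (B + outer x))) = (b ^ (2 * n) - b ^ (2 * i)) * g (u - 1)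
      + M * g (u + 1) + (b ^ (2 * i) - M) * g u" for g :: "nat \<Rightarrow> complex"
  proof -
    have "b ^ (2 * u) * (\<Sum>x\<in>R. g (nul (B + outer x))) = (\<Sum>y\<in>V. g (nul (B + outer (B *\<^sub>v y))))"
      using sum_comp_mult_mat_vec[OF Bc, of "\<lambda>x. g (nul (B + outer x))"] card_ker[OF Bc] b_even_power[of u]
      unfolding R_def u_def by metis
    also have "\<dots> = (\<Sum>y\<in>V. if qform B y = -1 then g (u + 1) else g u)"
      using nul_add_outer_in_range[OF B] by (intro sum.cong) (auto simp: u_def)
    also have "\<dots> = N * g (u + 1) + of_nat (card {y \<in> V. qform B y \<noteq> -1}) * g u"
      using finite_V by (simp add: sum.If_cases Int_def N_def)
    also have "of_nat (card {y \<in> V. qform B y \<noteq> -1}) = b ^ (2 * n) - N"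
    proof -
      have "card V = card {y \<in> V. qform B y = -1} + card {y \<in> V. qform B y \<noteq> -1}"
        using finite_V by (subst card_Un_disjoint[symmetric]) (auto intro!: arg_cong[of _ _ card])
      then have "complex_of_nat (card V) = N + of_nat (card {y \<in> V. qform B y \<noteq> -1})"
        by (simp only: N_def of_nat_add)
      then show ?thesis unfolding card_V b_even_power by simp
    qed
    also have "N * g (u + 1) + (b ^ (2 * n) - N) * g u
        = b ^ (2 * u) * (M * g (u + 1) + (b ^ (2 * i) - M) * g u)"
      unfolding NM n by (simp add: algebra_simps power_add)
    finally have "(\<Sum>x\<in>R. g (nul (B + outer x))) = M * g (u + 1) + (b ^ (2 * i) - M) * g u"
      by (subst (asm) mult_left_cancel) simp_all
    moreover have "(\<Sum>x\<in>V - R. g (nul (B + outer x))) = (\<Sum>x\<in>V - R. g (u - 1))"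
    proof (rule sum.cong[OF refl])
      fix x assume "x \<in> V - R"
      then have "nul B = Suc (nul (B + outer x))"
        using nul_add_outer_notin_range[OF B] unfolding R_def by blast
      then show "g (nul (B + outer x)) = g (u - 1)" by (simp add: u_def)
    qed
    moreover have "of_nat (card (V - R)) = b ^ (2 * n) - b ^ (2 * i)"
    proof -
      have "of_nat (card (V - R)) = complex_of_nat (card V) - of_nat (card R)"
        using R finite_V by (simp add: card_Diff_subset card_mono of_nat_diff)
      then show ?thesis unfolding card_V b_even_power cR .
    qed
    moreover have "(\<Sum>x\<in>V. g (nul (B + outer x)))
        = (\<Sum>x\<in>V - R. g (nul (B + outer x))) + (\<Sum>x\<in>R. g (nul (B + outer x)))"
      using R finite_V by (simp add: sum.subset_diff)
    ultimately show ?thesis by simp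
  qed
  show ?thesis using that[of M] M sum unfolding i_def u_def by blast
qed

section \<open>Fourier transform of rank functions\<close>

abbreviation chr :: "'a mat \<Rightarrow> 'a mat \<Rightarrow> complex" where
  "chr A B \<equiv> \<chi> (trace_form A B)"

lemma pairing_eq_chr:
  assumes "A \<in> H" "B \<in> H"
  shows "pairing q \<chi> A B = chr A B"
proof -
  have c: "A \<in> carrier_mat n n" "B \<in> carrier_mat n n" using assms herm_carrier by auto
  have "conj_transpose q A = A" using assms by (simp add: herm_def)
  then have "mat_trace (conj_transpose q A * B) = trace_form A B"
    using c unfolding mat_trace_def trace_form_def
    by (simp add: scalar_prod_def atLeast0LessThan)
  then show ?thesis by (simp add: pairing_def)
qed

lemma trace_form_commute: "trace_form A B = trace_form B A"
  unfolding trace_form_def by (subst sum.swap) (simp add: mult.commute)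

lemma trace_form_in_K:
  assumes "A \<in> H" "B \<in> H"
  shows "trace_form A B \<in> K"
proof -
  have "trace_form A B ^ q = (\<Sum>i<n. \<Sum>j<n. A $$ (j, i) * B $$ (i, j))"
    using assms by (auto simp: trace_form_def conj_sum power_mult_distrib herm_conj intro!: sum.cong)
  also have "\<dots> = trace_form A B" unfolding trace_form_def by (rule sum.swap)
  finally show ?thesis by (simp add: K_iff)
qed

lemma trace_form_linear:
  assumes "B \<in> carrier_mat n n" "C \<in> carrier_mat n n"
  shows "trace_form A (B + C) = trace_form A B + trace_form A C"
    "trace_form A (B - C) = trace_form A B - trace_form A C"
    "trace_form A (t \<cdot>\<^sub>m B) = t * trace_form A B"
  using assms by (simp_all add: trace_form_def distrib_left right_diff_distrib sum.distrib sum_subtractf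
      sum_distrib_left mult_ac)

lemma trace_form_outer:
  assumes A: "A \<in> carrier_mat n n" and x: "x \<in> V"
  shows "trace_form A (outer x) = qform A x"
proof -
  have "trace_form A (outer x) = (\<Sum>i<n. \<Sum>j<n. A $$ (i, j) * (x $ j * (x $ i) ^ q))"
    by (simp add: trace_form_def outer_def)
  also have "\<dots> = qform A x"
    unfolding qform_def hip_def using A x
    by (intro sum.cong refl) (simp add: mult_mat_vec_index sum_distrib_left mult_ac del: index_mult_mat_vec)
  finally show ?thesis .
qed

lemma chr_add:
  assumes "A \<in> H" "B \<in> H" "C \<in> H"
  shows "chr A (B + C) = chr A B * chr A C"
  using assms by (simp add: trace_form_linear herm_carrier chi_add trace_form_in_K)

lemma chr_diff:
  assumes "A \<in> H" "B \<in> H" "C \<in> H"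
  shows "chr A (B - C) = chr A B * cnj (chr A C)"
  using assms chi_add[of "trace_form A B" "- trace_form A C"]
  by (simp add: trace_form_linear herm_carrier cnj_chi trace_form_in_K K_closed)

lemma bij_add_herm: "C \<in> H \<Longrightarrow> bij_betw (\<lambda>A. A + C) H H"
proof (rule bij_betwI[of _ _ _ "\<lambda>A. A - C"])
  assume C: "C \<in> H"
  show "A + C - C = A" if "A \<in> H" for A
    using that C herm_carrier[of A] herm_carrier[of C] by (intro eq_matI) auto
  show "A - C + C = A" if "A \<in> H" for A
    using that C herm_carrier[of A] herm_carrier[of C] by (intro eq_matI) auto
qed (auto intro: herm_closed)

definition T :: "nat \<Rightarrow> 'a mat \<Rightarrow> complex" where
  "T s B = (\<Sum>A\<in>H. gauss_binom b (nul A) s * chr A B)"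

text \<open>Orthogonality of characters on the Hermitian matrices. For \<open>B\<close> nonzero, a
  scaled rank-one \<open>C\<close> built from a non-isotropic vector has
  \<open>trace_form B C = t\<close>, so shifting by \<open>C\<close> multiplies the sum by a number
  other than 1.\<close>

lemma T_0:
  assumes B: "B \<in> H"
  shows "T 0 B = (if B = 0\<^sub>m n n then of_nat (card H) else 0)"
proof (cases "B = 0\<^sub>m n n")
  case True
  then have "trace_form A B = 0" for A by (simp add: trace_form_def)
  then show ?thesis using True by (simp add: T_def)
next
  case False
  then obtain x where x: "x \<in> V" "qform B x \<noteq> 0" using qform_exists_nonzero[OF B] by auto
  obtain t where t: "t \<in> K" "\<chi> t \<noteq> 1" using nontrivial_char by (auto simp: nontrivial_char_def)
  define C where "C = (t / qform B x) \<cdot>\<^sub>m outer x"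
  have C: "C \<in> H" unfolding C_def using t qform_in_K[OF B x(1)] outer_herm K_closed by (intro herm_closed) auto
  have "trace_form B C = t"
    unfolding C_def using x herm_carrier[OF B] herm_carrier[OF outer_herm]
    by (simp add: trace_form_linear trace_form_outer)
  then have "(\<Sum>A\<in>H. chr B A) = 0"
    using chr_add[OF B] C t by (intro sum_eq_0_if_shift[OF bij_add_herm[OF C], of _ "\<chi> t"]) auto
  then show ?thesis using False by (simp add: T_def trace_form_commute[of B])
qed

text \<open>Absorption multiplied by \<open>b ^ s\<close>: it trades the factor
  \<open>b ^ u - b ^ s\<close> for a step from \<open>s\<close> to \<open>Suc s\<close>.\<close>

lemma gauss_binom_b_step:
  "b ^ s * (b ^ Suc s - 1) * gauss_binom b u (Suc s) = (b ^ u - b ^ s) * gauss_binom b u s"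
proof (cases "s \<le> u")
  case True
  then have "b ^ u = b ^ s * b ^ (u - s)" by (simp flip: power_add)
  then show ?thesis using gauss_binom_absorb_Suc[OF True, of b]
    by (simp only: mult.assoc) (simp add: algebra_simps)
next
  case False
  then show ?thesis by (simp add: gauss_binom_eq_0)
qed

text \<open>Summing over the updates multiplies the term of \<open>A\<close> by its Gauss sum.
  Subtracting \<open>b ^ (n + s) * T s B\<close> leaves the factor
  \<open>b ^ n * (b ^ nul A - b ^ s)\<close>, to which \<open>gauss_binom_b_step\<close>
  applies.\<close>

lemma T_Suc:
  assumes B: "B \<in> H"
  shows "b ^ (n + s) * (b ^ Suc s - 1) * T (Suc s) B = (\<Sum>x\<in>V. T s (B + outer x)) - b ^ (n + s) * T s B"
proof -
  have "(\<Sum>x\<in>V. T s (B + outer x)) = (\<Sum>A\<in>H. \<Sum>x\<in>V. gauss_binom b (nul A) s * chr A (B + outer x))"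
    unfolding T_def by (rule sum.swap)
  also have "\<dots> = (\<Sum>A\<in>H. gauss_binom b (nul A) s * chr A B * (b ^ n * b ^ nul A))"
  proof (rule sum.cong[OF refl])
    fix A assume A: "A \<in> H"
    have "(\<Sum>x\<in>V. gauss_binom b (nul A) s * chr A (B + outer x))
        = (\<Sum>x\<in>V. gauss_binom b (nul A) s * chr A B * \<chi> (qform A x))"
      using A B chr_add[OF A B outer_herm] trace_form_outer[OF herm_carrier[OF A]]
      by (intro sum.cong) auto
    then show "(\<Sum>x\<in>V. gauss_binom b (nul A) s * chr A (B + outer x))
        = gauss_binom b (nul A) s * chr A B * (b ^ n * b ^ nul A)"
      using gauss_sum[OF A] by (simp add: sum_distrib_left[symmetric])
  qed
  finally have 1: "(\<Sum>x\<in>V. T s (B + outer x)) = (\<Sum>A\<in>H. gauss_binom b (nul A) s * chr A B * (b ^ n * b ^ nul A))" .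
  have "(\<Sum>x\<in>V. T s (B + outer x)) - b ^ (n + s) * T s B
      = (\<Sum>A\<in>H. b ^ n * chr A B * ((b ^ nul A - b ^ s) * gauss_binom b (nul A) s))"
    unfolding 1 unfolding T_def sum_distrib_left sum_subtractf[symmetric]
    by (intro sum.cong refl) (simp add: algebra_simps power_add)
  also have "\<dots> = b ^ (n + s) * (b ^ Suc s - 1) * T (Suc s) B"
    unfolding T_def sum_distrib_left
    by (intro sum.cong refl) (simp only: gauss_binom_b_step[symmetric], simp only: power_add mult_ac)
  finally show ?thesis by simp
qed

lemma b_power_neq_1: "b ^ Suc s \<noteq> 1"
proof
  assume "b ^ Suc s = 1"
  then have "cmod b ^ Suc s = 1" by (metis norm_one norm_power)
  moreover have "cmod b \<ge> 2" using q_ge_2 by (simp add: b_def)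
  moreover have "cmod b > 1" using q_ge_2 by (simp add: b_def)
  ultimately show False using one_less_power[of "cmod b" "Suc s"] by simp
qed

text \<open>Stated with \<open>card H\<close> still unknown; its instance \<open>s = n\<close>
  determines \<open>card H\<close> afterwards. In the induction step, \<open>T s\<close> depends on
  the nullity alone, so \<open>sum_nul_add_outer\<close> evaluates the sum in \<open>T_Suc\<close>
  and \<open>gauss_binom_recurrence\<close> simplifies it.\<close>

lemma T_formula_aux:
  assumes "s \<le> n" "B \<in> H"
  shows "(- (b ^ n)) ^ s * T s B = of_nat (card H) * gauss_binom b (nul B) (n - s)"
  using assms
proof (induction s arbitrary: B)
  case 0
  show ?case
  proof (cases "B = 0\<^sub>m n n")
    case True
    then show ?thesis using T_0[OF 0(2)] by (simp add: nul_zero)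
  next
    case False
    then have "nul B < n" using nul_eq_n_iff[OF herm_carrier[OF 0(2)]] by (simp add: nul_def)
    then show ?thesis using False T_0[OF 0(2)] by (simp add: gauss_binom_eq_0)
  qed
next
  case (Suc s)
  define k where "k = n - Suc s"
  have k: "n - s = Suc k" "n = s + Suc k" using Suc.prems by (auto simp: k_def)
  define c where "c = of_nat (card H) / (- (b ^ n)) ^ s"
  have IH: "T s B' = c * gauss_binom b (nul B') (Suc k)" if "B' \<in> H" for B'
    using Suc.IH[of B'] Suc.prems that k by (simp add: c_def field_simps)
  obtain M where M: "b * M = - (b ^ (n - nul B) * (b ^ (n - nul B) - 1))"
    and sum: "\<And>g. (\<Sum>x\<in>V. g (nul (B + outer x))) = (b ^ (2 * n) - b ^ (2 * (n - nul B))) * g (nul B - 1)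
      + M * g (nul B + 1) + (b ^ (2 * (n - nul B)) - M) * g (nul B)"
    using sum_nul_add_outer[OF Suc.prems(2)] by blast
  have n: "n = (n - nul B) + nul B" by (simp add: nul_def)
  have "b ^ (n + s) * (b ^ Suc s - 1) * T (Suc s) B
      = (\<Sum>x\<in>V. c * gauss_binom b (nul (B + outer x)) (Suc k)) - b ^ (n + s) * (c * gauss_binom b (nul B) (Suc k))"
    unfolding T_Suc[OF Suc.prems(2)]
    using IH Suc.prems(2) herm_closed(2)[OF Suc.prems(2) outer_herm] by simp
  also have "\<dots> = c * ((\<Sum>x\<in>V. gauss_binom b (nul (B + outer x)) (Suc k)) - b ^ (n + s) * gauss_binom b (nul B) (Suc k))"
    by (simp add: sum_distrib_left right_diff_distrib mult_ac)
  also have "\<dots> = c * (- (b ^ s * (b ^ Suc s - 1) * gauss_binom b (nul B) k))"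
    unfolding sum[of "\<lambda>u. gauss_binom b u (Suc k)"]
      gauss_binom_recurrence[OF b_nonzero M n k(2)] ..
  finally have "(b ^ s * (b ^ Suc s - 1)) * (b ^ n * T (Suc s) B)
      = (b ^ s * (b ^ Suc s - 1)) * (- (c * gauss_binom b (nul B) k))"
    by (simp only: power_add) (simp add: algebra_simps)
  moreover have "b ^ s * (b ^ Suc s - 1) \<noteq> 0" using b_power_neq_1[of s] by simp
  ultimately have e: "b ^ n * T (Suc s) B = - (c * gauss_binom b (nul B) k)"
    by (rule mult_left_cancel[THEN iffD1, rotated])
  have "(- (b ^ n)) ^ Suc s * T (Suc s) B = - ((- (b ^ n)) ^ s * (b ^ n * T (Suc s) B))" by simp
  also have "\<dots> = ((- (b ^ n)) ^ s * c) * gauss_binom b (nul B) k" unfolding e by simp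
  also have "(- (b ^ n)) ^ s * c = of_nat (card H)" by (simp add: c_def)
  finally show ?case by (simp add: k_def)
qed

text \<open>Only the zero matrix has nullity \<open>n\<close>, so \<open>T n\<close> at zero is 1;
  \<open>T_formula_aux\<close> with \<open>s = n\<close> then gives the count.\<close>

lemma card_herm: "of_nat (card H) = (- (b ^ n)) ^ n"
proof -
  have "T n (0\<^sub>m n n) = (\<Sum>A\<in>H. if A = 0\<^sub>m n n then 1 else 0)"
    unfolding T_def
  proof (rule sum.cong[OF refl])
    fix A assume A: "A \<in> H"
    show "gauss_binom b (nul A) n * chr A (0\<^sub>m n n) = (if A = 0\<^sub>m n n then 1 else 0)"
    proof (cases "A = 0\<^sub>m n n")
      case True
      then show ?thesis by (simp add: nul_zero trace_form_def)
    next
      case False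
      then have "nul A < n" using nul_eq_n_iff[OF herm_carrier[OF A]] by (simp add: nul_def)
      then show ?thesis using False by (simp add: gauss_binom_eq_0)
    qed
  qed
  also have "\<dots> = 1" using finite_herm herm_closed(1) by simp
  finally show ?thesis using T_formula_aux[of n "0\<^sub>m n n"] herm_closed(1) by simp
qed

lemma T_formula:
  assumes "s \<le> n" "B \<in> H"
  shows "T s B = (- (b ^ n)) ^ (n - s) * gauss_binom b (nul B) (n - s)"
proof -
  have "(- (b ^ n)) ^ s * T s B = (- (b ^ n)) ^ (s + (n - s)) * gauss_binom b (nul B) (n - s)"
    using T_formula_aux[OF assms] card_herm assms(1) by simp
  then have "(- (b ^ n)) ^ s * T s B = (- (b ^ n)) ^ s * ((- (b ^ n)) ^ (n - s) * gauss_binom b (nul B) (n - s))"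
    by (simp only: power_add mult.assoc)
  moreover have "(- (b ^ n)) ^ s \<noteq> 0" by simp
  ultimately show ?thesis by (rule mult_left_cancel[THEN iffD1, rotated])
qed

section \<open>Codes and designs\<close>

lemma gauss_binom_b: "gauss_binom b u s = of_int (gauss_binom (- int q) u s)"
  by (simp add: of_int_gauss_binom b_def)

lemma herm_rank_nul: "A \<in> herm_rank q n k \<Longrightarrow> A \<in> H \<and> nul A = n - k"
  by (simp add: herm_rank_def nul_def)

lemma sum_by_rank:
  fixes f :: "'a mat \<Rightarrow> 'b::comm_monoid_add"
  shows "(\<Sum>A\<in>H. f A) = (\<Sum>k\<le>n. \<Sum>A\<in>herm_rank q n k. f A)"
  unfolding herm_rank_def
  by (rule sum.group[symmetric]) (use finite_herm mrank_le herm_carrier in auto)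

definition char_sum :: "nat \<Rightarrow> 'a mat \<Rightarrow> complex" where
  "char_sum k B = (\<Sum>A\<in>herm_rank q n k. chr A B)"

text \<open>The sums \<open>T s B\<close> depend only on the rank of \<open>B\<close>, and they determine the character sums
  over matrices of fixed rank by a unitriangular system.\<close>
lemma char_sum_cong:
  assumes B: "B \<in> H" "B' \<in> H" "mrank B = mrank B'" and k: "k \<le> n"
  shows "char_sum k B = char_sum k B'"
  using k
proof (induction k rule: less_induct)
  case (less k)
  have T: "T (n - k) C = char_sum k C + (\<Sum>j<k. gauss_binom b (n - j) (n - k) * char_sum j C)" for C
  proof -
    have "T (n - k) C = (\<Sum>j\<le>n. gauss_binom b (n - j) (n - k) * char_sum j C)"
      unfolding T_def sum_by_rank char_sum_def sum_distrib_left
      by (intro sum.cong refl) (auto dest: herm_rank_nul)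
    \<comment> \<open>For \<open>j > k\<close> the upper index is below \<open>n - k\<close>; at
      \<open>j = k\<close> the coefficient is 1, which makes the system unitriangular.\<close>
    also have "\<dots> = (\<Sum>j\<le>k. gauss_binom b (n - j) (n - k) * char_sum j C)"
      using less.prems by (intro sum.mono_neutral_right) (auto simp: gauss_binom_eq_0)
    also have "\<dots> = char_sum k C + (\<Sum>j<k. gauss_binom b (n - j) (n - k) * char_sum j C)"
      by (simp add: lessThan_Suc_atMost[symmetric])
    finally show ?thesis .
  qed
  have "T (n - k) B = T (n - k) B'"
    using T_formula[of "n - k"] B by (simp add: nul_def)
  moreover have "(\<Sum>j<k. gauss_binom b (n - j) (n - k) * char_sum j B)
      = (\<Sum>j<k. gauss_binom b (n - j) (n - k) * char_sum j B')"
    using less by (intro sum.cong) auto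
  ultimately show ?case using T[of B] T[of B'] by simp
qed

section \<open>Fourier coefficients and the dual inner distribution\<close>

definition fourier :: "'a mat set \<Rightarrow> 'a mat \<Rightarrow> complex" where
  "fourier Y A = (\<Sum>y\<in>Y. chr A y)"

text \<open>Up to the factor \<open>card Y\<close> this is the dual inner distribution, in a form
  that is manifestly real and nonnegative.\<close>

definition rank_weight :: "'a mat set \<Rightarrow> nat \<Rightarrow> real" where
  "rank_weight Y k = (\<Sum>A\<in>herm_rank q n k. (cmod (fourier Y A))\<^sup>2)"

lemma sum_chr_differences:
  assumes "A \<in> H" "Y \<subseteq> H"
  shows "(\<Sum>x\<in>Y. \<Sum>y\<in>Y. chr A (x - y)) = of_real ((cmod (fourier Y A))\<^sup>2)"
proof -
  have "(\<Sum>x\<in>Y. \<Sum>y\<in>Y. chr A (x - y)) = (\<Sum>x\<in>Y. \<Sum>y\<in>Y. chr A x * cnj (chr A y))"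
    using assms by (intro sum.cong refl chr_diff) auto
  also have "\<dots> = fourier Y A * cnj (fourier Y A)"
    unfolding fourier_def cnj_sum by (rule sum_product[symmetric])
  also have "\<dots> = of_real ((cmod (fourier Y A))\<^sup>2)"
    by (simp only: complex_norm_square)
  finally show ?thesis .
qed

lemma sum_differences_weighted:
  assumes "Y \<subseteq> H" "S \<subseteq> H"
  shows "(\<Sum>x\<in>Y. \<Sum>y\<in>Y. \<Sum>A\<in>S. f A * chr A (x - y))
    = (\<Sum>A\<in>S. f A * of_real ((cmod (fourier Y A))\<^sup>2))"
proof -
  have "(\<Sum>x\<in>Y. \<Sum>y\<in>Y. \<Sum>A\<in>S. f A * chr A (x - y)) = (\<Sum>x\<in>Y. \<Sum>A\<in>S. \<Sum>y\<in>Y. f A * chr A (x - y))"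
    by (intro sum.cong refl sum.swap)
  also have "\<dots> = (\<Sum>A\<in>S. \<Sum>x\<in>Y. \<Sum>y\<in>Y. f A * chr A (x - y))" by (rule sum.swap)
  also have "\<dots> = (\<Sum>A\<in>S. f A * of_real ((cmod (fourier Y A))\<^sup>2))"
  proof (rule sum.cong[OF refl])
    fix A assume "A \<in> S"
    then show "(\<Sum>x\<in>Y. \<Sum>y\<in>Y. f A * chr A (x - y)) = f A * of_real ((cmod (fourier Y A))\<^sup>2)"
      using sum_chr_differences[of A Y] assms by (auto simp: sum_distrib_left[symmetric])
  qed
  finally show ?thesis .
qed

text \<open>Pairs in \<open>Y\<close> are grouped by the rank of their difference; by
  \<open>char_sum_cong\<close> the representative chosen in \<open>Qnum\<close> may be replaced by
  that difference. Ranks that do not occur have weight 0, whatever \<open>Qnum\<close> is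
  there.\<close>

lemma dual_inner_dist_eq:
  assumes Y: "Y \<subseteq> H" "Y \<noteq> {}" and k: "k \<le> n"
  shows "of_nat (card Y) * dual_inner_dist q n \<chi> Y k = of_real (rank_weight Y k)"
proof -
  have fY: "finite Y" using Y(1) finite_herm finite_subset by blast
  define P where "P i = {(x, y). x \<in> Y \<and> y \<in> Y \<and> mrank (x - y) = i}" for i
  have P: "P i = {z \<in> Y \<times> Y. mrank (fst z - snd z) = i}" for i by (auto simp: P_def)
  have Qnum: "char_sum k (fst z - snd z) = Qnum q n \<chi> k i" if "z \<in> P i" for z i
  proof -
    have "fst z \<in> H" "snd z \<in> H" using that Y(1) by (auto simp: P)
    then have z: "fst z - snd z \<in> herm_rank q n i"
      using that herm_closed(3) by (simp add: P herm_rank_def)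
    define B where "B = (SOME B. B \<in> (herm_rank q n i :: 'a mat set))"
    have B: "B \<in> herm_rank q n i" unfolding B_def using z by (rule someI)
    have "Qnum q n \<chi> k i = char_sum k B"
      unfolding Qnum_def Let_def char_sum_def B_def[symmetric]
      using B by (intro sum.cong refl pairing_eq_chr) (auto simp: herm_rank_def)
    also have "\<dots> = char_sum k (fst z - snd z)"
      using z B k by (intro char_sum_cong) (auto simp: herm_rank_def)
    finally show ?thesis by simp
  qed
  have "of_nat (card Y) * dual_inner_dist q n \<chi> Y k = (\<Sum>i\<le>n. Qnum q n \<chi> k i * of_nat (card (P i)))"
    using fY Y(2) by (simp add: dual_inner_dist_def inner_dist_def P_def sum_distrib_left card_gt_0_iff)
  also have "\<dots> = (\<Sum>i\<le>n. \<Sum>z\<in>P i. char_sum k (fst z - snd z))"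
    using Qnum by (intro sum.cong) auto
  also have "\<dots> = (\<Sum>z\<in>Y \<times> Y. char_sum k (fst z - snd z))"
  proof -
    have "mrank (x - y) \<le> n" if "x \<in> Y" "y \<in> Y" for x y
      using that Y(1) by (intro mrank_le herm_carrier herm_closed(3)) auto
    then show ?thesis unfolding P using fY by (intro sum.group) auto
  qed
  also have "\<dots> = (\<Sum>x\<in>Y. \<Sum>y\<in>Y. char_sum k (x - y))"
    by (simp add: sum.cartesian_product case_prod_unfold)
  also have "\<dots> = of_real (rank_weight Y k)"
    using sum_differences_weighted[OF Y(1), of "herm_rank q n k" "\<lambda>_. 1"]
    by (simp add: char_sum_def rank_weight_def herm_rank_def)
  finally show ?thesis .
qed

lemma diff_self_herm: "A \<in> H \<Longrightarrow> A - A = 0\<^sub>m n n"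
  using herm_carrier[of A] by (intro eq_matI) auto

text \<open>\<open>T s (x - y)\<close> carries the factor \<open>[nul (x - y), n - s]\<close>, which
  is 0 for distinct \<open>x\<close> and \<open>y\<close>. The double sum over \<open>Y\<close> thus
  reduces to its diagonal, while exchanging sums expresses it through Fourier coefficients.\<close>

lemma code_identity:
  assumes Y: "Y \<subseteq> H" and s: "s \<le> n"
    and dist: "\<And>x y. x \<in> Y \<Longrightarrow> y \<in> Y \<Longrightarrow> x \<noteq> y \<Longrightarrow> nul (x - y) < n - s"
  shows "of_nat (card Y) * ((- (b ^ n)) ^ (n - s) * gauss_binom b n s)
    = (\<Sum>A\<in>H. gauss_binom b (nul A) s * of_real ((cmod (fourier Y A))\<^sup>2))"
proof -
  have fY: "finite Y" using Y finite_herm finite_subset by blast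
  have T: "T s (x - y) = (if x = y then (- (b ^ n)) ^ (n - s) * gauss_binom b n s else 0)"
    if "x \<in> Y" "y \<in> Y" for x y
  proof (cases "x = y")
    case True
    then have e: "x - y = 0\<^sub>m n n" using that Y diff_self_herm by auto
    show ?thesis unfolding e
      using True T_formula[OF s herm_closed(1)] gauss_binom_symmetric[OF s] by (simp add: nul_zero)
  next
    case False
    have "x - y \<in> H" using that Y herm_closed(3) by auto
    then show ?thesis using False T_formula[OF s] dist[OF that False] by (simp add: gauss_binom_eq_0)
  qed
  have "(\<Sum>x\<in>Y. \<Sum>y\<in>Y. T s (x - y))
      = (\<Sum>x\<in>Y. \<Sum>y\<in>Y. if x = y then (- (b ^ n)) ^ (n - s) * gauss_binom b n s else 0)"
    using T by (intro sum.cong refl) auto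
  also have "\<dots> = of_nat (card Y) * ((- (b ^ n)) ^ (n - s) * gauss_binom b n s)"
    using fY by simp
  finally show ?thesis
    using sum_differences_weighted[OF Y, of H "\<lambda>A. gauss_binom b (nul A) s"] unfolding T_def by simp
qed

lemma d_code_nul:
  assumes "d_code q n d Y" "1 \<le> d" "d \<le> n" "x \<in> Y" "y \<in> Y" "x \<noteq> y"
  shows "nul (x - y) < n - (d - 1)"
proof -
  have "mrank (x - y) \<ge> d" using assms by (auto simp: d_code_def)
  then show ?thesis using assms by (simp add: nul_def)
qed

section \<open>Additive codes\<close>

text \<open>The Fourier coefficient of a subgroup is \<open>card Y\<close> on its annihilator
  \<open>D\<close> and 0 elsewhere. The right side of \<open>code_identity\<close> is therefore
  \<open>card Y ^ 2\<close> times a sum of integers, and one factor cancels.\<close>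

lemma card_additive_dvd:
  assumes add: "additive_code q n Y" and s: "s \<le> n"
    and dist: "\<And>x y. x \<in> Y \<Longrightarrow> y \<in> Y \<Longrightarrow> x \<noteq> y \<Longrightarrow> nul (x - y) < n - s"
  shows "int (card Y) dvd (- ((- int q) ^ n)) ^ (n - s) * gauss_binom (- int q) n s"
proof -
  have Y: "Y \<subseteq> H" "0\<^sub>m n n \<in> Y" using add by (auto simp: additive_code_def)
  have fY: "finite Y" using Y finite_herm finite_subset by blast
  define D where "D = {A \<in> H. \<forall>y\<in>Y. chr A y = 1}"
  have F: "fourier Y A = (if A \<in> D then of_nat (card Y) else 0)" if A: "A \<in> H" for A
  proof (cases "A \<in> D")
    case True
    then show ?thesis by (simp add: fourier_def D_def)
  next
    case False
    then obtain z where z: "z \<in> Y" "chr A z \<noteq> 1" using A by (auto simp: D_def)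
    have zc: "z \<in> carrier_mat n n" using z Y herm_carrier by auto
    have "bij_betw (\<lambda>y. y + z) Y Y"
    proof (rule bij_betwI[of _ _ _ "\<lambda>y. y + (- z)"])
      show "y + z + - z = y" "y + - z + z = y" if "y \<in> Y" for y
        using that Y zc herm_carrier[of y] by (auto intro!: eq_matI)
    qed (use add z in \<open>auto simp: additive_code_def\<close>)
    then have "fourier Y A = 0"
      unfolding fourier_def using z Y A chr_add[OF A]
      by (intro sum_eq_0_if_shift[of _ _ _ "chr A z"]) (auto simp: subset_iff)
    then show ?thesis using False by simp
  qed
  have "of_nat (card Y) * ((- (b ^ n)) ^ (n - s) * gauss_binom b n s)
      = (\<Sum>A\<in>H. gauss_binom b (nul A) s * of_real ((cmod (fourier Y A))\<^sup>2))"
    by (rule code_identity[OF Y(1) s]) (rule dist)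
  also have "\<dots> = (\<Sum>A\<in>H. if A \<in> D then gauss_binom b (nul A) s * of_nat (card Y) ^ 2 else 0)"
    using F by (intro sum.cong refl) simp
  also have "\<dots> = (\<Sum>A\<in>D. gauss_binom b (nul A) s * of_nat (card Y) ^ 2)"
    using finite_herm by (intro sum.mono_neutral_cong_right) (auto simp: D_def)
  also have "\<dots> = of_nat (card Y) * (of_nat (card Y) * (\<Sum>A\<in>D. gauss_binom b (nul A) s))"
    by (simp add: sum_distrib_right[symmetric] power2_eq_square)
  finally have "(- (b ^ n)) ^ (n - s) * gauss_binom b n s
      = of_nat (card Y) * (\<Sum>A\<in>D. gauss_binom b (nul A) s)"
    using fY Y(2) by (subst (asm) mult_left_cancel) auto
  then have "complex_of_int ((- ((- int q) ^ n)) ^ (n - s) * gauss_binom (- int q) n s)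
      = of_int (int (card Y) * (\<Sum>A\<in>D. gauss_binom (- int q) (nul A) s))"
    by (simp add: of_int_gauss_binom b_def)
  then show ?thesis unfolding of_int_eq_iff by simp
qed

lemma additive_bound:
  assumes add: "additive_code q n Y" and code: "d_code q n d Y" and d: "1 \<le> d" "d \<le> n"
  shows "card (Y :: 'a mat set) \<le> q ^ (n * (n - d + 1))"
proof -
  have Y: "Y \<subseteq> H" using add by (auto simp: additive_code_def)
  define s where "s = d - 1"
  have s: "s \<le> n" "n - s = n - d + 1" using d by (auto simp: s_def)
  have sign: "a dvd (- ((- int q) ^ n)) ^ m \<longleftrightarrow> a dvd int q ^ (n * m)" for a m
  proof -
    have "(- ((- int q) ^ n)) ^ m = int q ^ (n * m) \<or> (- ((- int q) ^ n)) ^ m = - (int q ^ (n * m))"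
      by (cases "even n"; cases "even m") (auto simp: power_mult)
    then show ?thesis by auto
  qed
  \<comment> \<open>The instance \<open>s = 0\<close> plays the part of Lagrange's theorem: it shows
    that \<open>card Y\<close> divides a power of \<open>q\<close>.\<close>
  have "int (card Y) dvd (- ((- int q) ^ n)) ^ (n - 0) * gauss_binom (- int q) n 0"
  proof (rule card_additive_dvd[OF add])
    fix x y assume xy: "x \<in> Y" "y \<in> Y" "x \<noteq> y"
    show "nul (x - y) < n - 0" using d_code_nul[OF code d xy] by simp
  qed simp
  then have 1: "int (card Y) dvd int q ^ (n * n)" using sign by simp
  have "int (card Y) dvd (- ((- int q) ^ n)) ^ (n - s) * gauss_binom (- int q) n s"
    using d_code_nul[OF code d] s(1) unfolding s_def by (intro card_additive_dvd[OF add]) auto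
  moreover have "coprime (int (card Y)) (gauss_binom (- int q) n s)"
  proof -
    have "int q dvd gauss_binom (- int q) n s - 1" using s by (intro gauss_binom_mod) auto
    then obtain m where "gauss_binom (- int q) n s - 1 = int q * m" by (elim dvdE)
    then have "gauss_binom (- int q) n s = m * int q + 1" by (simp add: diff_eq_eq mult.commute)
    then have "coprime (int q) (gauss_binom (- int q) n s)"
      by (simp only: coprime_iff_gcd_eq_1 gcd_add_mult) simp
    then have "coprime (int q ^ (n * n)) (gauss_binom (- int q) n s)" by simp
    then show ?thesis using 1 coprime_divisors[OF 1 dvd_refl] by blast
  qed
  ultimately have "int (card Y) dvd (- ((- int q) ^ n)) ^ (n - s)"
    by (simp add: coprime_dvd_mult_left_iff)
  then have "int (card Y) dvd int (q ^ (n * (n - d + 1)))" unfolding sign s(2) by simp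
  then have "card Y dvd q ^ (n * (n - d + 1))" by (simp only: int_dvd_int_iff)
  then show ?thesis using q_ge_2 by (intro dvd_imp_le) auto
qed

section \<open>Codes for odd \<open>d\<close>\<close>

lemma rank_weight_0:
  assumes "Y \<subseteq> H"
  shows "rank_weight Y 0 = (real (card Y))\<^sup>2"
proof -
  have "mrank A = 0 \<longleftrightarrow> A = 0\<^sub>m n n" if "A \<in> H" for A
    using nul_eq_n_iff[OF herm_carrier[OF that]] mrank_le[OF herm_carrier[OF that]]
    by (auto simp: nul_def)
  then have "herm_rank q n 0 = {0\<^sub>m n n :: 'a mat}"
    using herm_closed(1) by (auto simp: herm_rank_def)
  moreover have "fourier Y (0\<^sub>m n n) = of_nat (card Y)"
    by (simp add: fourier_def trace_form_def)
  ultimately show ?thesis by (simp add: rank_weight_def)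
qed

lemma rank_weight_nonneg: "0 \<le> rank_weight Y k"
  by (simp add: rank_weight_def sum_nonneg)

lemma odd_code_identity:
  assumes code: "d_code q n d Y" and d: "1 \<le> d" "d \<le> n" "odd d"
  shows "real (card Y) * real (q ^ (n * (n - d + 1))) * real_of_int (gauss_binom (- int q) n (d - 1))
    = real_of_int (gauss_binom (- int q) n (d - 1)) * (real (card Y))\<^sup>2
      + (\<Sum>k\<in>{1..n - d + 1}. real_of_int (gauss_binom (- int q) (n - k) (d - 1)) * rank_weight Y k)"
proof -
  define s where "s = d - 1"
  have s: "s \<le> n" "n - s = n - d + 1" "even s" using d by (auto simp: s_def)
  have Y: "Y \<subseteq> H" using code by (simp add: d_code_def)
  define g where "g k = real_of_int (gauss_binom (- int q) (n - k) s)" for k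
  \<comment> \<open>As \<open>s\<close> is even, \<open>n\<close> and \<open>n - s\<close> have the
    same parity: for odd \<open>n\<close> the base is already positive, for even \<open>n\<close>
    the exponent is even.\<close>
  have sign: "(- (b ^ n)) ^ (n - s) = of_nat (q ^ (n * (n - s)))"
    using s(1,3) by (cases "even n") (simp_all add: b_def power_mult)
  have "complex_of_real (real (card Y) * real (q ^ (n * (n - s))) * g 0)
      = of_nat (card Y) * ((- (b ^ n)) ^ (n - s) * gauss_binom b n s)"
    unfolding sign by (simp add: gauss_binom_b g_def)
  also have "\<dots> = (\<Sum>A\<in>H. gauss_binom b (nul A) s * of_real ((cmod (fourier Y A))\<^sup>2))"
    using code_identity[OF Y s(1)] d_code_nul[OF code d(1,2)] unfolding s_def by blast
  also have "\<dots> = complex_of_real (\<Sum>k\<le>n. g k * rank_weight Y k)"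
    unfolding sum_by_rank rank_weight_def sum_distrib_left of_real_sum
    by (intro sum.cong refl) (auto dest: herm_rank_nul simp: g_def gauss_binom_b)
  finally have "real (card Y) * real (q ^ (n * (n - s))) * g 0 = (\<Sum>k\<le>n. g k * rank_weight Y k)"
    by (simp only: of_real_eq_iff)
  \<comment> \<open>Ranks above \<open>n - s\<close> drop out because then
    \<open>n - k < s\<close>.\<close>
  also have "\<dots> = (\<Sum>k\<in>insert 0 {1..n - s}. g k * rank_weight Y k)"
    using s(1) by (intro sum.mono_neutral_right) (auto simp: g_def gauss_binom_eq_0)
  also have "\<dots> = g 0 * (real (card Y))\<^sup>2 + (\<Sum>k\<in>{1..n - s}. g k * rank_weight Y k)"
    by (simp add: rank_weight_0[OF Y])
  finally show ?thesis unfolding g_def s(2) by (simp add: s_def)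
qed

lemma odd_bound_and_design:
  assumes code: "d_code q n d Y" and d: "1 \<le> d" "d \<le> n" "odd d"
  shows "card Y \<le> q ^ (n * (n - d + 1)) \<and>
    (card Y = q ^ (n * (n - d + 1)) \<longleftrightarrow> is_design q n \<chi> (n - d + 1) Y)"
proof -
  have Y: "Y \<subseteq> H" "Y \<noteq> {}" using code by (auto simp: d_code_def)
  have fY: "finite Y" using Y finite_herm finite_subset by blast
  define c Q where "c = real (card Y)" and "Q = real (q ^ (n * (n - d + 1)))"
  define g where "g k = real_of_int (gauss_binom (- int q) (n - k) (d - 1))" for k
  define R where "R = (\<Sum>k\<in>{1..n - d + 1}. g k * rank_weight Y k)"
  have c: "c > 0" using fY Y by (simp add: c_def card_gt_0_iff)
  have g: "g k > 0" if "k \<le> n - d + 1" for k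
    unfolding g_def of_int_0_less_iff using q_ge_2 d that by (intro gauss_binom_pos) auto
  have id: "c * Q * g 0 = g 0 * c\<^sup>2 + R"
    using odd_code_identity[OF code d] by (simp add: c_def Q_def g_def R_def)
  have nonneg: "0 \<le> g k * rank_weight Y k" if "k \<in> {1..n - d + 1}" for k
    using g[of k] that rank_weight_nonneg[of Y k] by auto
  have "R \<ge> 0" unfolding R_def using nonneg by (rule sum_nonneg)
  \<comment> \<open>This factorization gives both claims: \<open>R\<close> is nonnegative, so
    \<open>c \<le> Q\<close>, and equality means that every nonnegative summand of \<open>R\<close>
    vanishes.\<close>
  moreover have R: "R = (g 0 * c) * (Q - c)" using id by (simp add: algebra_simps power2_eq_square)
  moreover have gc: "g 0 * c > 0" using g[of 0] c by simp
  ultimately have "c \<le> Q" by (simp add: zero_le_mult_iff)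
  moreover have "c = Q \<longleftrightarrow> R = 0" using R gc by auto
  moreover have "R = 0 \<longleftrightarrow> (\<forall>k\<in>{1..n - d + 1}. g k * rank_weight Y k = 0)"
    unfolding R_def using nonneg by (intro sum_nonneg_eq_0_iff) auto
  moreover have "g k * rank_weight Y k = 0 \<longleftrightarrow> dual_inner_dist q n \<chi> Y k = 0"
    if "k \<in> {1..n - d + 1}" for k
  proof -
    have "complex_of_nat (card Y) \<noteq> 0" using c by (simp add: c_def)
    moreover have "k \<le> n" using that d by auto
    ultimately have "rank_weight Y k = 0 \<longleftrightarrow> dual_inner_dist q n \<chi> Y k = 0"
      using dual_inner_dist_eq[OF Y, of k] by (metis mult_eq_0_iff of_real_eq_0_iff)
    then show ?thesis using g[of k] that by auto
  qed
  ultimately have "c \<le> Q \<and> (c = Q \<longleftrightarrow> is_design q n \<chi> (n - d + 1) Y)"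
    using Y by (auto simp: is_design_def)
  then show ?thesis unfolding c_def Q_def of_nat_le_iff of_nat_eq_iff .
qed

end

theorem theorem3p1:
  fixes q n d :: nat and \<chi> :: "'a::{finite,field} \<Rightarrow> complex"
  assumes "\<exists>p k. prime p \<and> k \<ge> 1 \<and> q = p ^ k"
    and "card (UNIV :: 'a set) = q ^ 2"
    and "n \<ge> 1" and "1 \<le> d" and "d \<le> n"
    and "nontrivial_char q \<chi>"
  shows "(\<forall>Y::'a mat set. additive_code q n Y \<and> d_code q n d Y \<longrightarrow>
            card Y \<le> q ^ (n * (n - d + 1)))
       \<and> (odd d \<longrightarrow>
           (\<forall>Y::'a mat set. d_code q n d Y \<longrightarrow>
              card Y \<le> q ^ (n * (n - d + 1)) \<and>
              (card Y = q ^ (n * (n - d + 1)) \<longleftrightarrow> is_design q n \<chi> (n - d + 1) Y)))"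
proof -
  interpret hermitian_forms q n \<chi>
    using assms by unfold_locales
  show ?thesis
    using additive_bound odd_bound_and_design assms(4,5) by blast
qed

end
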